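(* For every special $\Pi^0_1$ sets $P,Q\subseteq2^{\mathbb N}$ there exists a $\Pi^0_1$ set $\widehat P\subseteq2^{\mathbb N}$ such that $Q\not\le^{<\omega}_\omega\widehat P$ and $\widehat P$ is $(\omega,1)$-equivalent to $P$.
   Context: A set is special if it is nonempty and contains no computable element. Let $\{\Phi_e\}_{e\in\mathbb N}$ be an effective enumeration of all partial computable functions $\Phi_e:\subseteq\mathbb N^{\mathbb N}\to\mathbb N^{\mathbb N}$. A learner is a total computable function $\Psi:\mathbb N^{<\mathbb N}\to\mathbb N$; let $\{\Psi_e\}_{e\in\mathbb N}$ be an effective enumeration of all learners. A partial function $\Gamma:\subseteq\mathbb N^{\mathbb N}\to\mathbb N^{\mathbb N}$ is identified by $\Psi$ on $g$ if $\lim_n\Psi(g\upharpoonright n)$ exists and $\Phi_{\lim_n\Psi(g\upharpoonright n)}(g)=\Gamma(g)$. $\Gamma$ is $(<\omega,\omega)$-computable if there is $b\in\mathbb N$ such that for every $g\in\mathrm{dom}(\Gamma)$, $\Gamma$ is identified by $\Psi_e$ on $g$ for some $e<b$. $\Gamma$ is $(\omega,1)$-computable if $\Gamma(g)\le_Tg$ for every $g\in\mathrm{dom}(\Gamma)$. For $A,B\subseteq\mathbb N^{\mathbb N}$, $A\le^\alpha_\beta B$ means there is an $(\alpha,\beta)$-computable $\Gamma$ with $B\subseteq\mathrm{dom}(\Gamma)$ and $\Gamma(g)\in A$ for every $g\in B$ (so $\le^\omega_1$ is Muchnik reducibility). $A$ and $B$ are $(\omega,1)$-equivalent if $A\le^\omega_1B$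 and $B\le^\omega_1A$. *)

theory Defs
  imports Complex_Main "HOL-Library.Nat_Bijection"
begin

section \<open>Oracle computability\<close>

text \<open>
  Programs for partial recursive functions with an oracle. All functions are unary; several
  arguments are passed through the pairing function \<^const>\<open>prod_encode\<close>.
\<close>

datatype code =
    CZero | CSucc | CFst | CSnd | COracle
  | CPair code code
  | CComp code code
  | CPrec code code
  | CMin code

primrec run :: "(nat \<Rightarrow> nat) \<Rightarrow> code \<Rightarrow> nat \<Rightarrow> nat option" where
  "run g CZero x = Some 0"
| "run g CSucc x = Some (Suc x)"
| "run g CFst x = Some (fst (prod_decode x))"
| "run g CSnd x = Some (snd (prod_decode x))"
| "run g COracle x = Some (g x)"
| "run g (CPair c d) x =
     (case (run g c x, run g d x) of
        (Some u, Some v) \<Rightarrow> Some (prod_encode (u, v)) | _ \<Rightarrow> None)"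
| "run g (CComp c d) x = (case run g d x of Some u \<Rightarrow> run g c u | None \<Rightarrow> None)"
| "run g (CPrec c d) x =
     (case prod_decode x of (a, n) \<Rightarrow>
        rec_nat (run g c a)
          (\<lambda>m r. case r of Some y \<Rightarrow> run g d (prod_encode (a, prod_encode (m, y))) | None \<Rightarrow> None)
          n)"
| "run g (CMin c) x =
     (if \<exists>n. run g c (prod_encode (x, n)) = Some 0 \<and>
             (\<forall>m<n. run g c (prod_encode (x, m)) \<noteq> None)
      then Some (LEAST n. run g c (prod_encode (x, n)) = Some 0)
      else None)"

primrec encode :: "code \<Rightarrow> nat" where
  "encode CZero = 0"
| "encode CSucc = 1"
| "encode CFst = 2"
| "encode CSnd = 3"
| "encode COracle = 4"
| "encode (CPair c d) = 5 + 4 * prod_encode (encode c, encode d)"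
| "encode (CComp c d) = 6 + 4 * prod_encode (encode c, encode d)"
| "encode (CPrec c d) = 7 + 4 * prod_encode (encode c, encode d)"
| "encode (CMin c) = 8 + 4 * encode c"

definition decode :: "nat \<Rightarrow> code" where
  "decode = inv encode"

lemma inj_encode: "inj encode"
proof (rule injI)
  have neq: "5 + 4 * a \<noteq> 6 + 4 * b" "5 + 4 * a \<noteq> 7 + 4 * b" "5 + 4 * a \<noteq> 8 + 4 * b"
    "6 + 4 * a \<noteq> 7 + 4 * b" "6 + 4 * a \<noteq> 8 + 4 * b" "7 + 4 * a \<noteq> 8 + 4 * b" for a b :: nat
    by presburger+
  show "c = d" if "encode c = encode d" for c d
    using that
  proof (induction c arbitrary: d)
    case CZero then show ?case by (cases d) simp_all
  next
    case CSucc then show ?case by (cases d) simp_all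
  next
    case CFst then show ?case by (cases d) simp_all
  next
    case CSnd then show ?case by (cases d) simp_all
  next
    case COracle then show ?case by (cases d) simp_all
  next
    case (CPair c1 c2)
    then show ?case by (cases d) (simp_all add: neq neq[symmetric])
  next
    case (CComp c1 c2)
    then show ?case by (cases d) (simp_all add: neq neq[symmetric])
  next
    case (CPrec c1 c2)
    then show ?case by (cases d) (simp_all add: neq neq[symmetric])
  next
    case (CMin c)
    then show ?case by (cases d) (simp_all add: neq neq[symmetric])
  qed
qed

lemma surj_encode: "surj encode"
proof -
  have "\<exists>c. encode c = n" for n
  proof (induction n rule: less_induct)
    case (less n)
    show ?case
    proof (cases "n < 5")
      case True
      then consider "n = 0" | "n = 1" | "n = 2" | "n = 3" | "n = 4" by linarith
      then show ?thesis
        using encode.simps(1-5) by cases blast+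
    next
      case False
      define m where "m = (n - 5) div 4"
      obtain a b where ab: "prod_decode m = (a, b)"
        by (cases "prod_decode m")
      then have m: "m = prod_encode (a, b)"
        by (metis prod_decode_inverse)
      have "m < n" using False unfolding m_def by presburger
      moreover have "a \<le> m" "b \<le> m"
        unfolding m by (rule le_prod_encode_1, rule le_prod_encode_2)
      ultimately obtain c d k where cd: "encode c = a" "encode d = b" "encode k = m"
        using less[of a] less[of b] less[of m] by auto
      have "n = 5 + 4 * m \<or> n = 6 + 4 * m \<or> n = 7 + 4 * m \<or> n = 8 + 4 * m"
        using False unfolding m_def by presburger
      then consider "encode (CPair c d) = n" | "encode (CComp c d) = n"
        | "encode (CPrec c d) = n" | "encode (CMin k) = n"
        using cd m by auto
      then show ?thesis by cases blast+
    qed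
  qed
  then show ?thesis unfolding surj_def by metis
qed

lemma bij_encode: "bij encode"
  using inj_encode surj_encode by (rule bijI)

lemma decode_encode [simp]: "decode (encode c) = c"
  by (simp add: decode_def inj_encode)

lemma encode_decode [simp]: "encode (decode e) = e"
  by (simp add: decode_def surj_encode surj_f_inv_f)

text \<open>The \<open>e\<close>-th partial computable function on Baire space, with its natural domain.\<close>

definition Phi :: "nat \<Rightarrow> (nat \<Rightarrow> nat) \<rightharpoonup> (nat \<Rightarrow> nat)" where
  "Phi e g =
     (if \<forall>n. run g (decode e) n \<noteq> None then Some (\<lambda>n. the (run g (decode e) n)) else None)"

definition turing_le :: "(nat \<Rightarrow> nat) \<Rightarrow> (nat \<Rightarrow> nat) \<Rightarrow> bool"  (infix \<open>\<le>\<^sub>T\<close> 50) where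
  "f \<le>\<^sub>T g \<longleftrightarrow> (\<exists>c. \<forall>n. run g c n = Some (f n))"

lemma turing_le_iff_Phi: "f \<le>\<^sub>T g \<longleftrightarrow> (\<exists>e. Phi e g = Some f)"
proof
  assume "f \<le>\<^sub>T g"
  then obtain c where "\<forall>n. run g c n = Some (f n)"
    by (auto simp: turing_le_def)
  then have "Phi (encode c) g = Some f" by (simp add: Phi_def)
  then show "\<exists>e. Phi e g = Some f" ..
next
  assume "\<exists>e. Phi e g = Some f"
  then obtain e where e: "Phi e g = Some f" ..
  then have total: "\<forall>n. run g (decode e) n \<noteq> None"
    unfolding Phi_def by (metis option.distinct(1))
  with e have "f = (\<lambda>n. the (run g (decode e) n))"
    unfolding Phi_def by simp
  with total have "\<forall>n. run g (decode e) n = Some (f n)" by force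
  then show "f \<le>\<^sub>T g" unfolding turing_le_def by blast
qed

text \<open>Absolute computability is computability with the constant zero oracle.\<close>

definition computable :: "(nat \<Rightarrow> nat) \<Rightarrow> bool" where
  "computable f \<longleftrightarrow> f \<le>\<^sub>T (\<lambda>_. 0)"

definition computable_on_strings :: "(nat list \<Rightarrow> nat) \<Rightarrow> bool" where
  "computable_on_strings \<Psi> \<longleftrightarrow> computable (\<lambda>x. \<Psi> (list_decode x))"


section \<open>Effectively closed sets\<close>

definition initseg :: "(nat \<Rightarrow> nat) \<Rightarrow> nat \<Rightarrow> nat list" where
  "initseg g n = map g [0..<n]"

definition cantor_space :: "(nat \<Rightarrow> nat) set" where
  "cantor_space = {g. \<forall>n. g n \<in> {0, 1}}"

definition Pi01 :: "(nat \<Rightarrow> nat) set \<Rightarrow> bool" where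
  "Pi01 A \<longleftrightarrow>
     (\<exists>R :: nat list \<Rightarrow> bool.
        computable_on_strings (\<lambda>\<sigma>. of_bool (R \<sigma>)) \<and> A = {g. \<forall>n. R (initseg g n)})"

definition special :: "(nat \<Rightarrow> nat) set \<Rightarrow> bool" where
  "special A \<longleftrightarrow> A \<noteq> {} \<and> (\<forall>g\<in>A. \<not> computable g)"


section \<open>Learners and reducibilities\<close>

definition is_learner :: "(nat list \<Rightarrow> nat) \<Rightarrow> bool" where
  "is_learner \<Psi> \<longleftrightarrow> computable_on_strings \<Psi>"

text \<open>
  The total computable functions admit no uniformly computable listing. The learners are therefore
  enumerated by the standard indices of partial computable functions, where an index of a function
  that is not total is assigned the constant zero learner. Only the set of listed learners matters
  for \<open>fin_omega_computable\<close> below, see \<open>fin_omega_computable_iff_finite\<close>.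
\<close>

definition learner :: "nat \<Rightarrow> nat list \<Rightarrow> nat" where
  "learner e =
     (if \<forall>x. run (\<lambda>_. 0) (decode e) x \<noteq> None
      then (\<lambda>\<sigma>. the (run (\<lambda>_. 0) (decode e) (list_encode \<sigma>)))
      else (\<lambda>_. 0))"

lemma is_learner_iff:
  "is_learner \<Psi> \<longleftrightarrow> (\<exists>c. \<forall>n. run (\<lambda>_. 0) c n = Some (\<Psi> (list_decode n)))"
  unfolding is_learner_def computable_on_strings_def computable_def turing_le_def ..

lemma range_learner: "range learner = {\<Psi>. is_learner \<Psi>}"
proof (intro equalityI subsetI)
  fix \<Psi> assume "\<Psi> \<in> range learner"
  then obtain e where e: "\<Psi> = learner e" by blast
  have "is_learner (learner e)"
  proof (cases "\<forall>x. run (\<lambda>_. 0) (decode e) x \<noteq> None")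
    case True
    then have "\<forall>n. run (\<lambda>_. 0) (decode e) n = Some (learner e (list_decode n))"
      by (simp add: learner_def)
    then show ?thesis unfolding is_learner_iff by blast
  next
    case False
    then have "\<forall>n. run (\<lambda>_. 0) CZero n = Some (learner e (list_decode n))"
      unfolding learner_def by (simp only: if_False run.simps simp_thms)
    then show ?thesis unfolding is_learner_iff by blast
  qed
  with e show "\<Psi> \<in> {\<Psi>. is_learner \<Psi>}" by simp
next
  fix \<Psi> assume "\<Psi> \<in> {\<Psi>. is_learner \<Psi>}"
  then obtain c where "\<forall>n. run (\<lambda>_. 0) c n = Some (\<Psi> (list_decode n))"
    unfolding is_learner_iff by blast
  then have "\<Psi> = learner (encode c)" by (simp add: learner_def)
  then show "\<Psi> \<in> range learner" by blast
qed

text \<open>The limit is taken in the discrete topology of \<^typ>\<open>nat\<close>.\<close>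

definition identified_on ::
  "((nat \<Rightarrow> nat) \<rightharpoonup> (nat \<Rightarrow> nat)) \<Rightarrow> (nat list \<Rightarrow> nat) \<Rightarrow> (nat \<Rightarrow> nat) \<Rightarrow> bool" where
  "identified_on \<Gamma> \<Psi> g \<longleftrightarrow>
     convergent (\<lambda>n. \<Psi> (initseg g n)) \<and> Phi (lim (\<lambda>n. \<Psi> (initseg g n))) g = \<Gamma> g"

definition fin_omega_computable :: "((nat \<Rightarrow> nat) \<rightharpoonup> (nat \<Rightarrow> nat)) \<Rightarrow> bool" where
  "fin_omega_computable \<Gamma> \<longleftrightarrow>
     (\<exists>b. \<forall>g\<in>dom \<Gamma>. \<exists>e<b. identified_on \<Gamma> (learner e) g)"

lemma fin_omega_computable_iff_finite:
  "fin_omega_computable \<Gamma> \<longleftrightarrow>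
     (\<exists>L. finite L \<and> (\<forall>\<Psi>\<in>L. is_learner \<Psi>) \<and> (\<forall>g\<in>dom \<Gamma>. \<exists>\<Psi>\<in>L. identified_on \<Gamma> \<Psi> g))"
proof
  assume "fin_omega_computable \<Gamma>"
  then obtain b where "\<forall>g\<in>dom \<Gamma>. \<exists>e<b. identified_on \<Gamma> (learner e) g"
    by (auto simp: fin_omega_computable_def)
  moreover have "\<forall>\<Psi>\<in>learner ` {..<b}. is_learner \<Psi>"
    using range_learner by blast
  ultimately show "\<exists>L. finite L \<and> (\<forall>\<Psi>\<in>L. is_learner \<Psi>) \<and>
      (\<forall>g\<in>dom \<Gamma>. \<exists>\<Psi>\<in>L. identified_on \<Gamma> \<Psi> g)"
    by (intro exI[of _ "learner ` {..<b}"]) auto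
next
  assume "\<exists>L. finite L \<and> (\<forall>\<Psi>\<in>L. is_learner \<Psi>) \<and>
      (\<forall>g\<in>dom \<Gamma>. \<exists>\<Psi>\<in>L. identified_on \<Gamma> \<Psi> g)"
  then obtain L where L: "finite L" "L \<subseteq> range learner"
    "\<forall>g\<in>dom \<Gamma>. \<exists>\<Psi>\<in>L. identified_on \<Gamma> \<Psi> g"
    using range_learner by blast
  then obtain E where E: "finite E" "L = learner ` E"
    by (meson finite_subset_image)
  then obtain b where "\<forall>e\<in>E. e < b"
    using finite_nat_set_iff_bounded by blast
  moreover have "\<exists>e\<in>E. identified_on \<Gamma> (learner e) g" if "g \<in> dom \<Gamma>" for g
    using L(3) that unfolding E(2) by (metis imageE)
  ultimately show "fin_omega_computable \<Gamma>"
    unfolding fin_omega_computable_def by metis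
qed

definition omega_one_computable :: "((nat \<Rightarrow> nat) \<rightharpoonup> (nat \<Rightarrow> nat)) \<Rightarrow> bool" where
  "omega_one_computable \<Gamma> \<longleftrightarrow> (\<forall>g\<in>dom \<Gamma>. the (\<Gamma> g) \<le>\<^sub>T g)"

definition reducible_via ::
  "(((nat \<Rightarrow> nat) \<rightharpoonup> (nat \<Rightarrow> nat)) \<Rightarrow> bool) \<Rightarrow> (nat \<Rightarrow> nat) set \<Rightarrow> (nat \<Rightarrow> nat) set \<Rightarrow> bool" where
  "reducible_via C A B \<longleftrightarrow> (\<exists>\<Gamma>. C \<Gamma> \<and> B \<subseteq> dom \<Gamma> \<and> (\<forall>g\<in>B. the (\<Gamma> g) \<in> A))"

definition fin_omega_le :: "(nat \<Rightarrow> nat) set \<Rightarrow> (nat \<Rightarrow> nat) set \<Rightarrow> bool" where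
  "fin_omega_le = reducible_via fin_omega_computable"

definition omega_one_le :: "(nat \<Rightarrow> nat) set \<Rightarrow> (nat \<Rightarrow> nat) set \<Rightarrow> bool" where
  "omega_one_le = reducible_via omega_one_computable"

definition omega_one_equiv :: "(nat \<Rightarrow> nat) set \<Rightarrow> (nat \<Rightarrow> nat) set \<Rightarrow> bool" where
  "omega_one_equiv A B \<longleftrightarrow> omega_one_le A B \<and> omega_one_le B A"

end

theory Submission
  imports Defs "HOL-Library.Sublist"
begin

text \<open>
  By induction on \<open>n\<close> one constructs an effectively closed set \<open>P\<^sub>n\<close>, all of whose elements
  compute elements of \<open>P\<close>, such that no \<open>n\<close> learners together succeed on \<open>P\<^sub>n\<close>; here \<open>P\<^sub>0 = P\<close>.
  An element of \<open>P\<^bsub>n+1\<^esub>\<close> is a sequence of blocks taken from the tree of \<open>P\<^sub>n\<close>. Abandoning a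
  block costs one bit of an element \<open>q\<close> of \<open>P\<close>, so whoever pays infinitely often has computed \<open>q\<close>.
  It is free only at the first block that lets a certain program \<open>e\<close>, determined by the number of bits
  paid so far, compute a longer string in the tree of \<open>Q\<close>. Infinitely many free steps in a row would
  follow a computable path and give a computable element of \<open>Q\<close>; hence they end at a string above
  which \<open>e\<close> fails on a whole copy of \<open>P\<^sub>n\<close>.

  Now let \<open>n + 1\<close> learners be given and fix \<open>q\<close>. If one of them has a constant value \<open>e\<close> above some
  string that pays bits of \<open>q\<close>, then it fails on such a copy of \<open>P\<^sub>n\<close>, on which the other \<open>n\<close>
  learners are defeated by the induction hypothesis. Otherwise every learner can be made to change its
  mind again and again, and one path that pays all of \<open>q\<close> makes all of them diverge. Finally the
  sets \<open>P\<^sub>n\<close> are glued to \<open>P\<close> and the elements are replaced by their graphs.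
\<close>

section \<open>Uniform computability on encodable types\<close>

text \<open>The coding is onto, so every number decodes to a value: a program never meets an invalid
  code, and bounded quantifiers over values become bounded quantifiers over numbers.\<close>

class encodable =
  fixes enc :: "'a \<Rightarrow> nat"
  assumes bij_enc: "bij enc"
begin

definition dec :: "nat \<Rightarrow> 'a" where
  "dec = inv enc"

lemma dec_enc [simp]: "dec (enc x) = x"
  by (simp add: dec_def bij_enc bij_is_inj)

lemma enc_dec [simp]: "enc (dec n) = n"
  by (simp add: dec_def bij_enc bij_is_surj surj_f_inv_f)

lemma enc_eq_iff [simp]: "enc x = enc y \<longleftrightarrow> x = y"
  by (metis dec_enc)

lemma Ex_enc_less_iff: "(\<exists>a. enc a < n \<and> P a) \<longleftrightarrow> (\<exists>i<n. P (dec i))"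
  by (metis dec_enc enc_dec)

lemma All_enc_less_iff: "(\<forall>a. enc a < n \<longrightarrow> P a) \<longleftrightarrow> (\<forall>i<n. P (dec i))"
  by (metis dec_enc enc_dec)

end

instantiation nat :: encodable
begin

definition enc_nat :: "nat \<Rightarrow> nat" where
  [simp]: "enc_nat n = n"

instance
  by standard (simp add: bij_def inj_def surj_def)

end

instantiation code :: encodable
begin

definition enc_code :: "code \<Rightarrow> nat" where
  [simp]: "enc_code = encode"

instance
  by standard (simp add: bij_encode)

end

instantiation prod :: (encodable, encodable) encodable
begin

definition enc_prod :: "'a \<times> 'b \<Rightarrow> nat" where
  "enc_prod x = prod_encode (enc (fst x), enc (snd x))"

instance
proof
  show "bij (enc :: 'a \<times> 'b \<Rightarrow> nat)"
    by (rule bij_betw_byWitness[where f' = "\<lambda>n. (dec (fst (prod_decode n)), dec (snd (prod_decode n)))"])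
      (auto simp: enc_prod_def)
qed

end

lemma enc_Pair [simp]: "enc (a, b) = prod_encode (enc a, enc b)"
  by (simp add: enc_prod_def)

instantiation list :: (encodable) encodable
begin

definition enc_list :: "'a list \<Rightarrow> nat" where
  "enc_list l = list_encode (map enc l)"

instance
proof
  show "bij (enc :: 'a list \<Rightarrow> nat)"
    by (rule bij_betw_byWitness[where f' = "\<lambda>n. map dec (list_decode n)"])
      (auto simp: enc_list_def o_def)
qed

end

lemma enc_Nil [simp]: "enc ([] :: 'a::encodable list) = 0"
  by (simp add: enc_list_def)

lemma enc_Cons [simp]: "enc (a # l) = Suc (prod_encode (enc a, enc l))"
  by (simp add: enc_list_def)

lemma enc_nat_list: "enc \<sigma> = list_encode \<sigma>" for \<sigma> :: "nat list"
  by (simp add: enc_list_def map_idI)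

lemma length_le_enc: "length l \<le> enc l"
proof (induction l)
  case (Cons a l)
  then show ?case
    using le_prod_encode_2[of "enc l" "enc a"] by simp
qed simp

text \<open>One program has to serve all oracles in \<open>G\<close>. With \<open>G = UNIV\<close>
  it gives a total functional; with \<open>G = {g}\<close> it may contain a search that is only
  known to halt for the oracle \<open>g\<close>, which suffices for Turing reductions.\<close>

definition ucomp ::
  "(nat \<Rightarrow> nat) set \<Rightarrow> ((nat \<Rightarrow> nat) \<Rightarrow> 'a::encodable \<Rightarrow> 'b::encodable) \<Rightarrow> bool" where
  "ucomp G F \<longleftrightarrow> (\<exists>c. \<forall>g\<in>G. \<forall>x. run g c (enc x) = Some (enc (F g x)))"

definition udec ::
  "(nat \<Rightarrow> nat) set \<Rightarrow> ((nat \<Rightarrow> nat) \<Rightarrow> 'a::encodable \<Rightarrow> bool) \<Rightarrow> bool" where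
  "udec G P \<longleftrightarrow> ucomp G (\<lambda>g x. of_bool (P g x) :: nat)"

named_theorems ucomp_intros

lemma ucompI:
  assumes "\<And>g x. g \<in> G \<Longrightarrow> run g c (enc x) = Some (enc (F g x))"
  shows "ucomp G F"
  using assms unfolding ucomp_def by blast

lemma ucompE:
  assumes "ucomp G F"
  obtains c where "\<And>g x. g \<in> G \<Longrightarrow> run g c (enc x) = Some (enc (F g x))"
  using assms unfolding ucomp_def by blast

lemma ucomp_mono: "ucomp G F \<Longrightarrow> H \<subseteq> G \<Longrightarrow> ucomp H F"
  unfolding ucomp_def by blast

lemma udec_mono: "udec G P \<Longrightarrow> H \<subseteq> G \<Longrightarrow> udec H P"
  unfolding udec_def by (rule ucomp_mono)

lemma ucomp_cong:
  assumes "ucomp G F" and "\<And>g x. g \<in> G \<Longrightarrow> F g x = F' g x"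
  shows "ucomp G F'"
  using assms unfolding ucomp_def by (metis (no_types, lifting))

lemma ucomp_enc_cong:
  fixes F :: "(nat \<Rightarrow> nat) \<Rightarrow> 'a::encodable \<Rightarrow> 'b::encodable"
    and F' :: "(nat \<Rightarrow> nat) \<Rightarrow> 'a \<Rightarrow> 'c::encodable"
  assumes "ucomp G F" and "\<And>g x. g \<in> G \<Longrightarrow> enc (F' g x) = enc (F g x)"
  shows "ucomp G F'"
  using assms unfolding ucomp_def by (metis (no_types, lifting))

lemma udec_cong:
  assumes "udec G P" and "\<And>g x. g \<in> G \<Longrightarrow> P g x = P' g x"
  shows "udec G P'"
  using assms unfolding udec_def by (elim ucomp_cong) simp

lemma ucomp_compose:
  assumes "ucomp G F" and "ucomp G H"
  shows "ucomp G (\<lambda>g x. F g (H g x))"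
proof -
  obtain c where c: "\<And>g x. g \<in> G \<Longrightarrow> run g c (enc x) = Some (enc (F g x))"
    using assms(1) by (rule ucompE) blast
  obtain d where d: "\<And>g x. g \<in> G \<Longrightarrow> run g d (enc x) = Some (enc (H g x))"
    using assms(2) by (rule ucompE) blast
  show ?thesis
    by (rule ucompI[of _ "CComp c d"]) (simp add: c d)
qed

lemma udec_compose: "udec G P \<Longrightarrow> ucomp G H \<Longrightarrow> udec G (\<lambda>g x. P g (H g x))"
  unfolding udec_def by (rule ucomp_compose)

lemma ucomp_id [ucomp_intros]: "ucomp G (\<lambda>g x. x)"
  by (rule ucompI[of _ "CPair CFst CSnd"]) simp

lemma ucomp_const [ucomp_intros]: "ucomp G (\<lambda>g x. k)"
proof -
  have "\<exists>c. \<forall>g x. run g c x = Some n" for n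
  proof (induction n)
    case 0
    show ?case by (rule exI[of _ CZero]) simp
  next
    case (Suc n)
    then obtain c where "\<forall>g x. run g c x = Some n" ..
    then show ?case by (intro exI[of _ "CComp CSucc c"]) simp
  qed
  then show ?thesis
    unfolding ucomp_def by meson
qed

lemma ucomp_Pair [ucomp_intros]:
  assumes "ucomp G A" and "ucomp G B"
  shows "ucomp G (\<lambda>g x. (A g x, B g x))"
proof -
  obtain c where c: "\<And>g x. g \<in> G \<Longrightarrow> run g c (enc x) = Some (enc (A g x))"
    using assms(1) by (rule ucompE) blast
  obtain d where d: "\<And>g x. g \<in> G \<Longrightarrow> run g d (enc x) = Some (enc (B g x))"
    using assms(2) by (rule ucompE) blast
  show ?thesis
    by (rule ucompI[of _ "CPair c d"]) (simp add: c d)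
qed

lemma ucomp_fst [ucomp_intros]: "ucomp G A \<Longrightarrow> ucomp G (\<lambda>g x. fst (A g x))"
  by (rule ucomp_compose[of G "\<lambda>g. fst"]) (auto intro: ucompI[of _ CFst] simp: enc_prod_def)

lemma ucomp_snd [ucomp_intros]: "ucomp G A \<Longrightarrow> ucomp G (\<lambda>g x. snd (A g x))"
  by (rule ucomp_compose[of G "\<lambda>g. snd"]) (auto intro: ucompI[of _ CSnd] simp: enc_prod_def)

lemma ucomp_Suc [ucomp_intros]: "ucomp G A \<Longrightarrow> ucomp G (\<lambda>g x. Suc (A g x))"
  by (rule ucomp_compose[of G "\<lambda>g. Suc"]) (auto intro: ucompI[of _ CSucc])

lemma ucomp_oracle [ucomp_intros]: "ucomp G A \<Longrightarrow> ucomp G (\<lambda>g x. g (A g x))"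
  by (rule ucomp_compose[of G "\<lambda>g. g"]) (auto intro: ucompI[of _ COracle])

lemma ucomp_enc [ucomp_intros]: "ucomp G A \<Longrightarrow> ucomp G (\<lambda>g x. enc (A g x))"
  by (erule ucomp_enc_cong) simp

lemma ucomp_dec [ucomp_intros]: "ucomp G A \<Longrightarrow> ucomp G (\<lambda>g x. dec (A g x))"
  by (erule ucomp_enc_cong) simp

lemma ucomp_prod_encode [ucomp_intros]: "ucomp G A \<Longrightarrow> ucomp G (\<lambda>g x. prod_encode (A g x))"
  by (erule ucomp_enc_cong) (simp add: enc_prod_def)

lemma ucomp_prod_decode [ucomp_intros]: "ucomp G A \<Longrightarrow> ucomp G (\<lambda>g x. prod_decode (A g x))"
  by (erule ucomp_enc_cong) (simp add: enc_prod_def)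

lemma ucomp_rec_nat [ucomp_intros]:
  assumes "ucomp G A" and "ucomp G N"
    and "ucomp G (\<lambda>g z. F g (fst z) (fst (snd z)) (snd (snd z)))"
  shows "ucomp G (\<lambda>g x. rec_nat (A g x) (\<lambda>m r. F g x m r) (N g x))"
proof -
  obtain a where a: "\<And>g x. g \<in> G \<Longrightarrow> run g a (enc x) = Some (enc (A g x))"
    using assms(1) by (rule ucompE) blast
  obtain f where f: "\<And>g z. g \<in> G \<Longrightarrow>
      run g f (enc z) = Some (enc (F g (fst z) (fst (snd z)) (snd (snd z))))"
    using assms(3) by (rule ucompE) blast
  have f': "run g f (prod_encode (enc x, prod_encode (m, enc r))) = Some (enc (F g x m r))"
    if "g \<in> G" for g x m r
    using f[OF that, of "(x, m, r)"] by simp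
  have "ucomp G (\<lambda>g y. rec_nat (A g (fst y)) (\<lambda>m r. F g (fst y) m r) (snd y))"
  proof (rule ucompI[of _ "CPrec a f"])
    fix g and y :: "'a \<times> nat"
    assume g: "g \<in> G"
    have "rec_nat (run g a (enc x))
        (\<lambda>m r. case r of Some y \<Rightarrow> run g f (prod_encode (enc x, prod_encode (m, y))) | None \<Rightarrow> None) n =
      Some (enc (rec_nat (A g x) (\<lambda>m r. F g x m r) n))" for x n
      by (induction n) (simp_all add: a f' g)
    then show "run g (CPrec a f) (enc y) =
        Some (enc (rec_nat (A g (fst y)) (\<lambda>m r. F g (fst y) m r) (snd y)))"
      by (simp add: enc_prod_def)
  qed
  from ucomp_compose[OF this ucomp_Pair[OF ucomp_id assms(2)]] show ?thesis
    by simp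
qed

lemma ucomp_pred [ucomp_intros]:
  assumes "ucomp G A"
  shows "ucomp G (\<lambda>g x. A g x - 1 :: nat)"
proof -
  have "ucomp G (\<lambda>g x. rec_nat 0 (\<lambda>m r. m) (A g x))"
    by (intro ucomp_intros assms)
  moreover have "rec_nat 0 (\<lambda>m r. m) n = n - 1" for n :: nat
    by (cases n) simp_all
  ultimately show ?thesis by simp
qed

lemma ucomp_plus [ucomp_intros]:
  assumes "ucomp G A" and "ucomp G B"
  shows "ucomp G (\<lambda>g x. A g x + B g x :: nat)"
proof -
  have "ucomp G (\<lambda>g x. rec_nat (A g x) (\<lambda>m r. Suc r) (B g x))"
    by (intro ucomp_intros assms)
  moreover have "rec_nat a (\<lambda>m r. Suc r) n = a + n" for a n :: nat
    by (induction n) simp_all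
  ultimately show ?thesis by simp
qed

lemma ucomp_minus [ucomp_intros]:
  assumes "ucomp G A" and "ucomp G B"
  shows "ucomp G (\<lambda>g x. A g x - B g x :: nat)"
proof -
  have "ucomp G (\<lambda>g x. rec_nat (A g x) (\<lambda>m r. r - 1) (B g x))"
    by (intro ucomp_intros assms)
  moreover have "rec_nat a (\<lambda>m r. r - 1) n = a - n" for a n :: nat
    by (induction n) simp_all
  ultimately show ?thesis by simp
qed

lemma ucomp_times [ucomp_intros]:
  assumes "ucomp G A" and "ucomp G B"
  shows "ucomp G (\<lambda>g x. A g x * B g x :: nat)"
proof -
  have "ucomp G (\<lambda>g x. rec_nat 0 (\<lambda>m r. A g x + r) (B g x))"
    by (intro ucomp_intros assms ucomp_compose[of G A])
  moreover have "rec_nat 0 (\<lambda>m r. a + r) n = a * n" for a n :: nat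
    by (induction n) simp_all
  ultimately show ?thesis by simp
qed

section \<open>Decidable predicates, case distinction and unbounded search\<close>

lemma ucomp_of_bool [ucomp_intros]: "udec G P \<Longrightarrow> ucomp G (\<lambda>g x. of_bool (P g x) :: nat)"
  by (simp add: udec_def)

lemma udec_less [ucomp_intros]:
  fixes A B :: "(nat \<Rightarrow> nat) \<Rightarrow> 'a::encodable \<Rightarrow> nat"
  assumes "ucomp G A" and "ucomp G B"
  shows "udec G (\<lambda>g x. A g x < B g x)"
proof -
  have "ucomp G (\<lambda>g x. 1 - (1 - (B g x - A g x)))"
    by (intro ucomp_intros assms)
  then show ?thesis
    unfolding udec_def by (elim ucomp_cong) auto
qed

lemma udec_Not [ucomp_intros]: "udec G P \<Longrightarrow> udec G (\<lambda>g x. \<not> P g x)"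
  unfolding udec_def
  by (drule ucomp_minus[OF ucomp_const[of G 1]]) (auto elim: ucomp_cong)

lemma udec_conj [ucomp_intros]:
  assumes "udec G P" and "udec G R"
  shows "udec G (\<lambda>g x. P g x \<and> R g x)"
  using ucomp_times[OF assms[unfolded udec_def]]
  unfolding udec_def by (rule ucomp_cong) simp

lemma udec_disj [ucomp_intros]:
  assumes "udec G P" and "udec G R"
  shows "udec G (\<lambda>g x. P g x \<or> R g x)"
  using udec_Not[OF udec_conj[OF udec_Not[OF assms(1)] udec_Not[OF assms(2)]]]
  by (rule udec_cong) simp

lemma udec_imp [ucomp_intros]:
  assumes "udec G P" and "udec G R"
  shows "udec G (\<lambda>g x. P g x \<longrightarrow> R g x)"
  using udec_disj[OF udec_Not[OF assms(1)] assms(2)]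
  by (rule udec_cong) simp

lemma udec_le [ucomp_intros]:
  fixes A B :: "(nat \<Rightarrow> nat) \<Rightarrow> 'a::encodable \<Rightarrow> nat"
  assumes "ucomp G A" and "ucomp G B"
  shows "udec G (\<lambda>g x. A g x \<le> B g x)"
  using udec_less[OF assms(1) ucomp_Suc[OF assms(2)]]
  by (rule udec_cong) auto

lemma udec_eq [ucomp_intros]:
  fixes A B :: "(nat \<Rightarrow> nat) \<Rightarrow> 'a::encodable \<Rightarrow> 'b::encodable"
  assumes "ucomp G A" and "ucomp G B"
  shows "udec G (\<lambda>g x. A g x = B g x)"
proof -
  have "udec G (\<lambda>g x. enc (A g x) \<le> enc (B g x) \<and> enc (B g x) \<le> enc (A g x))"
    by (intro ucomp_intros assms)
  then show ?thesis
    by (rule udec_cong) (metis enc_eq_iff le_antisym order_refl)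
qed

lemma udec_case_prod [ucomp_intros]:
  "udec G (\<lambda>g x. P g x (fst (A g x)) (snd (A g x))) \<Longrightarrow>
    udec G (\<lambda>g x. case A g x of (a, b) \<Rightarrow> P g x a b)"
  by (simp add: case_prod_unfold)

lemma ucomp_If [ucomp_intros]:
  assumes "udec G P" and "ucomp G A" and "ucomp G B"
  shows "ucomp G (\<lambda>g x. if P g x then A g x else B g x)"
proof -
  have "ucomp G (\<lambda>g x. rec_nat (B g x) (\<lambda>m r. A g x) (of_bool (P g x)))"
    by (intro ucomp_intros assms ucomp_compose[OF assms(2)])
  then show ?thesis
    by (rule ucomp_cong) simp
qed

lemma udec_If [ucomp_intros]:
  assumes "udec G P" and "udec G R" and "udec G S"
  shows "udec G (\<lambda>g x. if P g x then R g x else S g x)"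
proof -
  have "udec G (\<lambda>g x. P g x \<and> R g x \<or> \<not> P g x \<and> S g x)"
    by (intro ucomp_intros assms)
  then show ?thesis
    by (rule udec_cong) simp
qed

lemma udec_All_less [ucomp_intros]:
  fixes P :: "(nat \<Rightarrow> nat) \<Rightarrow> 'a::encodable \<Rightarrow> nat \<Rightarrow> bool"
  assumes "ucomp G N" and "udec G (\<lambda>g z. P g (fst z) (snd z))"
  shows "udec G (\<lambda>g x. \<forall>i<N g x. P g x i)"
proof -
  have "ucomp G (\<lambda>g x. rec_nat 1 (\<lambda>i r. of_bool (P g x i) * r :: nat) (N g x))"
    by (intro ucomp_intros assms(1) udec_compose[OF assms(2), of "\<lambda>g z. (fst z, fst (snd z))", simplified])
  moreover have "rec_nat 1 (\<lambda>i r. of_bool (Q i) * r) n = (of_bool (\<forall>i<n. Q i) :: nat)" for Q n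
    by (induction n) (auto simp: less_Suc_eq)
  ultimately show ?thesis
    unfolding udec_def by (elim ucomp_cong) simp
qed

lemma udec_Ex_less [ucomp_intros]:
  fixes P :: "(nat \<Rightarrow> nat) \<Rightarrow> 'a::encodable \<Rightarrow> nat \<Rightarrow> bool"
  assumes "ucomp G N" and "udec G (\<lambda>g z. P g (fst z) (snd z))"
  shows "udec G (\<lambda>g x. \<exists>i<N g x. P g x i)"
proof -
  have "udec G (\<lambda>g x. \<not> (\<forall>i<N g x. \<not> P g x i))"
    by (intro ucomp_intros assms)
  then show ?thesis by simp
qed

lemma udec_All_enc_less [ucomp_intros]:
  assumes "ucomp G N" and "udec G (\<lambda>g z. P g (fst z) (snd z))"
  shows "udec G (\<lambda>g x. \<forall>a. enc a < N g x \<longrightarrow> P g x a)"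
  unfolding All_enc_less_iff
  by (intro ucomp_intros assms(1) udec_compose[OF assms(2), of "\<lambda>g z. (fst z, dec (snd z))", simplified])

lemma udec_Ex_enc_less [ucomp_intros]:
  assumes "ucomp G N" and "udec G (\<lambda>g z. P g (fst z) (snd z))"
  shows "udec G (\<lambda>g x. \<exists>a. enc a < N g x \<and> P g x a)"
  unfolding Ex_enc_less_iff
  by (intro ucomp_intros assms(1) udec_compose[OF assms(2), of "\<lambda>g z. (fst z, dec (snd z))", simplified])

lemma ucomp_Least:
  fixes P :: "(nat \<Rightarrow> nat) \<Rightarrow> 'a::encodable \<Rightarrow> nat \<Rightarrow> bool"
  assumes "udec G (\<lambda>g z. P g (fst z) (snd z))"
    and ex: "\<And>g x. g \<in> G \<Longrightarrow> \<exists>n. P g x n"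
  shows "ucomp G (\<lambda>g x. LEAST n. P g x n)"
proof -
  have "ucomp G (\<lambda>g z. of_bool (\<not> P g (fst z) (snd z)) :: nat)"
    by (intro ucomp_intros assms(1))
  then obtain c where c: "\<And>g z. g \<in> G \<Longrightarrow>
      run g c (enc z) = Some (enc (of_bool (\<not> P g (fst z) (snd z)) :: nat))"
    by (rule ucompE) blast
  have c': "run g c (prod_encode (enc x, n)) = Some (of_bool (\<not> P g x n))" if "g \<in> G" for g x n
    using c[OF that, of "(x, n)"] by simp
  show ?thesis
  proof (rule ucompI[of _ "CMin c"])
    show "run g (CMin c) (enc x) = Some (enc (LEAST n. P g x n))" if "g \<in> G" for g x
      using ex[OF that, of x] by (simp add: c'[OF that])
  qed
qed

subsection \<open>Lists\<close>

text \<open>The default \<open>dec 0\<close> fits the arithmetic: as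
  \<open>prod_decode 0 = (0, 0)\<close>, one formula computes the code of the head from the code of
  any list, empty or not.\<close>

definition head :: "'a::encodable list \<Rightarrow> 'a" where
  "head l = (case l of [] \<Rightarrow> dec 0 | a # _ \<Rightarrow> a)"

lemma head_Cons [simp]: "head (a # l) = a"
  by (simp add: head_def)

lemma prod_decode_0: "prod_decode 0 = (0, 0)"
  by (simp add: prod_decode_def prod_decode_aux.simps)

lemma enc_head: "enc (head l) = fst (prod_decode (enc l - 1))"
  by (cases l) (simp_all add: head_def prod_decode_0)

lemma enc_tl: "enc (tl l) = snd (prod_decode (enc l - 1))"
  by (cases l) (simp_all add: prod_decode_0)

lemma ucomp_head [ucomp_intros]:
  assumes "ucomp G L"
  shows "ucomp G (\<lambda>g x. head (L g x))"
proof -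
  have "ucomp G (\<lambda>g x. fst (prod_decode (enc (L g x) - 1)))"
    by (intro ucomp_intros assms)
  then show ?thesis
    by (rule ucomp_enc_cong) (simp add: enc_head)
qed

lemma ucomp_tl [ucomp_intros]:
  assumes "ucomp G L"
  shows "ucomp G (\<lambda>g x. tl (L g x))"
proof -
  have "ucomp G (\<lambda>g x. snd (prod_decode (enc (L g x) - 1)))"
    by (intro ucomp_intros assms)
  then show ?thesis
    by (rule ucomp_enc_cong) (simp add: enc_tl)
qed

lemma ucomp_Cons [ucomp_intros]:
  assumes "ucomp G A" and "ucomp G L"
  shows "ucomp G (\<lambda>g x. A g x # L g x)"
proof -
  have "ucomp G (\<lambda>g x. Suc (prod_encode (enc (A g x), enc (L g x))))"
    by (intro ucomp_intros assms)
  then show ?thesis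
    by (rule ucomp_enc_cong) simp
qed

lemma ucomp_foldl [ucomp_intros]:
  assumes "ucomp G I" and "ucomp G L"
    and "ucomp G (\<lambda>g z. F g (fst z) (fst (snd z)) (snd (snd z)))"
  shows "ucomp G (\<lambda>g x. foldl (\<lambda>r a. F g x r a) (I g x) (L g x))"
proof -
  \<comment> \<open>The state holds the value so far and the rest of the list. The recursion runs
    for \<open>enc l\<close> steps, a bound on the length; once the list is used up the state stays
    fixed.\<close>
  let ?step = "\<lambda>f p. if snd p = [] then p else (f (fst p) (head (snd p)), tl (snd p))"
  have fold: "length l \<le> n \<Longrightarrow> rec_nat (i, l) (\<lambda>m. ?step f) n = (foldl f i l, [])"
    for f :: "'b \<Rightarrow> 'c \<Rightarrow> 'b" and i l n
  proof (induction n arbitrary: i l)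
    case (Suc n)
    have shift: "rec_nat p (\<lambda>m. h) (Suc n) = rec_nat (h p) (\<lambda>m. h) n"
      for p and h :: "'b \<times> 'c list \<Rightarrow> 'b \<times> 'c list"
      by (induction n) simp_all
    show ?case
    proof (cases l)
      case Nil
      then show ?thesis using Suc.IH[of l i] by (simp add: shift del: nat.rec)
    next
      case (Cons a l')
      then show ?thesis using Suc.IH[of l' "f i a"] Suc.prems by (simp add: shift del: nat.rec)
    qed
  qed simp
  have "ucomp G (\<lambda>g x. rec_nat (I g x, L g x) (\<lambda>m p. if snd p = [] then p
      else (F g x (fst p) (head (snd p)), tl (snd p))) (enc (L g x)))"
    by (intro ucomp_intros assms(1,2)
        ucomp_compose[OF assms(3), of "\<lambda>g z. (fst z, (fst (snd (snd z)), head (snd (snd (snd z)))))", simplified])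
  then have "ucomp G (\<lambda>g x. fst (rec_nat (I g x, L g x) (\<lambda>m p. if snd p = [] then p
      else (F g x (fst p) (head (snd p)), tl (snd p))) (enc (L g x))))"
    by (rule ucomp_fst)
  then show ?thesis
    by (rule ucomp_cong) (subst fold[OF length_le_enc], simp)
qed

lemma ucomp_rev [ucomp_intros]:
  assumes "ucomp G L"
  shows "ucomp G (\<lambda>g x. rev (L g x))"
proof -
  have "ucomp G (\<lambda>g x. foldl (\<lambda>r a. a # r) [] (L g x))"
    by (intro ucomp_intros assms)
  then show ?thesis
    by (simp add: foldl_conv_fold fold_Cons_rev[unfolded fun_eq_iff])
qed

lemma ucomp_append [ucomp_intros]:
  assumes "ucomp G L" and "ucomp G M"
  shows "ucomp G (\<lambda>g x. L g x @ M g x)"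
proof -
  have "ucomp G (\<lambda>g x. foldl (\<lambda>r a. a # r) (M g x) (rev (L g x)))"
    by (intro ucomp_intros assms)
  then show ?thesis
    by (simp add: foldl_conv_fold fold_Cons_rev[unfolded fun_eq_iff])
qed

lemma ucomp_length [ucomp_intros]:
  fixes L :: "(nat \<Rightarrow> nat) \<Rightarrow> 'a::encodable \<Rightarrow> 'b::encodable list"
  assumes "ucomp G L"
  shows "ucomp G (\<lambda>g x. length (L g x))"
proof -
  have "ucomp G (\<lambda>g x. foldl (\<lambda>r a. Suc r) 0 (L g x))"
    by (intro ucomp_intros assms)
  moreover have "foldl (\<lambda>r a. Suc r) k l = k + length l" for k and l :: "'b list"
    by (induction l arbitrary: k) simp_all
  ultimately show ?thesis by simp
qed

lemma ucomp_map [ucomp_intros]: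
  fixes L :: "(nat \<Rightarrow> nat) \<Rightarrow> 'a::encodable \<Rightarrow> 'b::encodable list"
    and F :: "(nat \<Rightarrow> nat) \<Rightarrow> 'a \<Rightarrow> 'b \<Rightarrow> 'c::encodable"
  assumes "ucomp G L" and "ucomp G (\<lambda>g z. F g (fst z) (snd z))"
  shows "ucomp G (\<lambda>g x. map (\<lambda>a. F g x a) (L g x))"
proof -
  have "ucomp G (\<lambda>g x. foldl (\<lambda>r a. r @ [F g x a]) [] (L g x))"
    by (intro ucomp_intros assms(1)
        ucomp_compose[OF assms(2), of "\<lambda>g z. (fst z, snd (snd z))", simplified])
  moreover have "foldl (\<lambda>r a. r @ [f a]) k l = k @ map f l" for k and f :: "'b \<Rightarrow> 'c" and l
    by (induction l arbitrary: k) simp_all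
  ultimately show ?thesis by simp
qed

lemma ucomp_filter [ucomp_intros]:
  fixes L :: "(nat \<Rightarrow> nat) \<Rightarrow> 'a::encodable \<Rightarrow> 'b::encodable list"
  assumes "ucomp G L" and "udec G (\<lambda>g z. P g (fst z) (snd z))"
  shows "ucomp G (\<lambda>g x. filter (\<lambda>a. P g x a) (L g x))"
proof -
  have "ucomp G (\<lambda>g x. foldl (\<lambda>r a. if P g x a then r @ [a] else r) [] (L g x))"
    by (intro ucomp_intros assms(1)
        udec_compose[OF assms(2), of "\<lambda>g z. (fst z, snd (snd z))", simplified])
  moreover have "foldl (\<lambda>r a. if p a then r @ [a] else r) k l = k @ filter p l" for k p and l :: "'b list"
    by (induction l arbitrary: k) simp_all
  ultimately show ?thesis by simp
qed

lemma udec_Ball_set [ucomp_intros]: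
  assumes "ucomp G L" and "udec G (\<lambda>g z. P g (fst z) (snd z))"
  shows "udec G (\<lambda>g x. \<forall>a\<in>set (L g x). P g x a)"
proof -
  have "udec G (\<lambda>g x. filter (\<lambda>a. \<not> P g x a) (L g x) = [])"
    by (intro ucomp_intros assms)
  then show ?thesis
    by (rule udec_cong) (auto simp: filter_empty_conv)
qed

lemma udec_Bex_set [ucomp_intros]:
  assumes "ucomp G L" and "udec G (\<lambda>g z. P g (fst z) (snd z))"
  shows "udec G (\<lambda>g x. \<exists>a\<in>set (L g x). P g x a)"
proof -
  have "udec G (\<lambda>g x. filter (\<lambda>a. P g x a) (L g x) \<noteq> [])"
    by (intro ucomp_intros assms)
  then show ?thesis
    by (rule udec_cong) (auto simp: filter_empty_conv)
qed

lemma udec_mem [ucomp_intros]: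
  assumes "ucomp G A" and "ucomp G L"
  shows "udec G (\<lambda>g x. A g x \<in> set (L g x))"
proof -
  have "udec G (\<lambda>g x. \<exists>a\<in>set (L g x). a = A g x)"
    by (intro ucomp_intros assms ucomp_compose[OF assms(1), of "\<lambda>g. fst"])
  then show ?thesis by simp
qed

lemma ucomp_map_upt [ucomp_intros]:
  fixes F :: "(nat \<Rightarrow> nat) \<Rightarrow> 'a::encodable \<Rightarrow> nat \<Rightarrow> 'b::encodable"
  assumes "ucomp G N" and "ucomp G (\<lambda>g z. F g (fst z) (snd z))"
  shows "ucomp G (\<lambda>g x. map (\<lambda>i. F g x i) [0..<N g x])"
proof -
  have "ucomp G (\<lambda>g x. rec_nat [] (\<lambda>i r. r @ [F g x i]) (N g x))"
    by (intro ucomp_intros assms(1)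
        ucomp_compose[OF assms(2), of "\<lambda>g z. (fst z, fst (snd z))", simplified])
  moreover have "rec_nat [] (\<lambda>i r. r @ [f i]) n = map f [0..<n]" for f :: "nat \<Rightarrow> 'b" and n
    by (induction n) simp_all
  ultimately show ?thesis by simp
qed

lemma ucomp_initseg [ucomp_intros]:
  "ucomp G N \<Longrightarrow> ucomp G (\<lambda>g z. F g (fst z) (snd z)) \<Longrightarrow> ucomp G (\<lambda>g x. initseg (\<lambda>i. F g x i) (N g x))"
  unfolding initseg_def by (rule ucomp_map_upt)

text \<open>Indexing by \<open>(!)\<close> is not computable, since its values beyond the end of a list are unspecified.\<close>

definition nth0 :: "'a::encodable list \<Rightarrow> nat \<Rightarrow> 'a"  (infixl \<open>!!\<close> 100) where
  "l !! i = head (drop i l)"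

lemma nth0_eq_nth [simp]: "i < length l \<Longrightarrow> l !! i = l ! i"
  by (simp add: nth0_def Cons_nth_drop_Suc[symmetric])

lemma ucomp_drop [ucomp_intros]:
  fixes L :: "(nat \<Rightarrow> nat) \<Rightarrow> 'a::encodable \<Rightarrow> 'b::encodable list"
  assumes "ucomp G N" and "ucomp G L"
  shows "ucomp G (\<lambda>g x. drop (N g x) (L g x))"
proof -
  have "ucomp G (\<lambda>g x. rec_nat (L g x) (\<lambda>m r. tl r) (N g x))"
    by (intro ucomp_intros assms)
  moreover have "rec_nat l (\<lambda>m r. tl r) n = drop n l" for l :: "'b list" and n
    by (induction n) (simp_all add: drop_Suc tl_drop)
  ultimately show ?thesis by simp
qed

lemma ucomp_nth0 [ucomp_intros]:
  "ucomp G L \<Longrightarrow> ucomp G N \<Longrightarrow> ucomp G (\<lambda>g x. L g x !! N g x)"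
  unfolding nth0_def by (intro ucomp_intros)

lemma ucomp_take [ucomp_intros]:
  fixes L :: "(nat \<Rightarrow> nat) \<Rightarrow> 'a::encodable \<Rightarrow> 'b::encodable list"
  assumes "ucomp G N" and "ucomp G L"
  shows "ucomp G (\<lambda>g x. take (N g x) (L g x))"
proof -
  have "ucomp G (\<lambda>g x. rev (drop (length (L g x) - N g x) (rev (L g x))))"
    by (intro ucomp_intros assms)
  moreover have "rev (drop (length l - n) (rev l)) = take n l" for l :: "'b list" and n
    by (cases "n \<le> length l") (simp_all add: drop_rev)
  ultimately show ?thesis by simp
qed

section \<open>Oracle substitution\<close>

primrec oracle_subst :: "code \<Rightarrow> code \<Rightarrow> code" where
  "oracle_subst c CZero = CZero"
| "oracle_subst c CSucc = CSucc"
| "oracle_subst c CFst = CFst"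
| "oracle_subst c CSnd = CSnd"
| "oracle_subst c COracle = c"
| "oracle_subst c (CPair d e) = CPair (oracle_subst c d) (oracle_subst c e)"
| "oracle_subst c (CComp d e) = CComp (oracle_subst c d) (oracle_subst c e)"
| "oracle_subst c (CPrec d e) = CPrec (oracle_subst c d) (oracle_subst c e)"
| "oracle_subst c (CMin d) = CMin (oracle_subst c d)"

lemma run_oracle_subst:
  assumes "\<And>n. run h c n = Some (g n)"
  shows "run h (oracle_subst c d) = run g d"
  by (induction d) (auto simp: fun_eq_iff assms cong: option.case_cong)

lemma ucomp_oracle_subst:
  fixes H :: "(nat \<Rightarrow> nat) \<Rightarrow> nat \<Rightarrow> nat"
  assumes "ucomp G H" and "ucomp K F" and "\<And>g. g \<in> G \<Longrightarrow> H g \<in> K"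
  shows "ucomp G (\<lambda>g x. F (H g) x)"
proof -
  obtain c where c: "\<And>g n. g \<in> G \<Longrightarrow> run g c n = Some (H g n)"
    using assms(1) unfolding ucomp_def by auto
  obtain d where d: "\<And>g x. g \<in> K \<Longrightarrow> run g d (enc x) = Some (enc (F g x))"
    using assms(2) by (rule ucompE) blast
  show ?thesis
    by (rule ucompI[of _ "oracle_subst c d"]) (simp add: run_oracle_subst[OF c] d assms(3))
qed

lemma turing_le_iff_ucomp: "f \<le>\<^sub>T g \<longleftrightarrow> ucomp {g} (\<lambda>_. f)"
  by (simp add: turing_le_def ucomp_def)

lemma turing_le_trans: "f \<le>\<^sub>T g \<Longrightarrow> g \<le>\<^sub>T h \<Longrightarrow> f \<le>\<^sub>T h"
  unfolding turing_le_iff_ucomp by (rule ucomp_oracle_subst[of "{h}" "\<lambda>_. g" "{g}"]) simp_all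

lemma computable_iff_ucomp: "computable f \<longleftrightarrow> ucomp UNIV (\<lambda>_. f)"
proof
  assume "computable f"
  then have "ucomp {\<lambda>_. 0} (\<lambda>_. f)"
    by (simp add: computable_def turing_le_iff_ucomp)
  \<comment> \<open>The zero oracle is itself computable, so it can be substituted for whatever
    oracle is given.\<close>
  with ucomp_const show "ucomp UNIV (\<lambda>_. f)"
    by (rule ucomp_oracle_subst) simp
next
  assume "ucomp UNIV (\<lambda>_. f)"
  then show "computable f"
    unfolding computable_def turing_le_iff_ucomp by (rule ucomp_mono) simp
qed

lemma computable_on_strings_iff_udec:
  "computable_on_strings (\<lambda>\<sigma>. of_bool (R \<sigma>)) \<longleftrightarrow> udec UNIV (\<lambda>_. R)"
proof -
  have "ucomp UNIV (\<lambda>_ n. of_bool (R (list_decode n)) :: nat) \<longleftrightarrow> ucomp UNIV (\<lambda>_ \<sigma>. of_bool (R \<sigma>) :: nat)"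
    unfolding ucomp_def by (metis enc_nat_def enc_nat_list list_decode_inverse list_encode_inverse)
  then show ?thesis
    by (simp add: computable_on_strings_def computable_iff_ucomp udec_def)
qed

section \<open>Computable operations on programs\<close>

lemma ucomp_CPair [ucomp_intros]:
  assumes "ucomp G A" and "ucomp G B"
  shows "ucomp G (\<lambda>g x. CPair (A g x) (B g x))"
proof -
  have "ucomp G (\<lambda>g x. 5 + 4 * prod_encode (enc (A g x), enc (B g x)))"
    by (intro ucomp_intros assms)
  then show ?thesis by (rule ucomp_enc_cong) simp
qed

lemma ucomp_CComp [ucomp_intros]:
  assumes "ucomp G A" and "ucomp G B"
  shows "ucomp G (\<lambda>g x. CComp (A g x) (B g x))"
proof -
  have "ucomp G (\<lambda>g x. 6 + 4 * prod_encode (enc (A g x), enc (B g x)))"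
    by (intro ucomp_intros assms)
  then show ?thesis by (rule ucomp_enc_cong) simp
qed

lemma ucomp_CPrec [ucomp_intros]:
  assumes "ucomp G A" and "ucomp G B"
  shows "ucomp G (\<lambda>g x. CPrec (A g x) (B g x))"
proof -
  have "ucomp G (\<lambda>g x. 7 + 4 * prod_encode (enc (A g x), enc (B g x)))"
    by (intro ucomp_intros assms)
  then show ?thesis by (rule ucomp_enc_cong) simp
qed

lemma ucomp_CMin [ucomp_intros]:
  assumes "ucomp G A"
  shows "ucomp G (\<lambda>g x. CMin (A g x))"
proof -
  have "ucomp G (\<lambda>g x. 8 + 4 * enc (A g x))"
    by (intro ucomp_intros assms)
  then show ?thesis by (rule ucomp_enc_cong) simp
qed

text \<open>The template \<open>d\<close> is fixed and the program put in place of the oracle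
  varies, so the induction on \<open>d\<close> takes place outside the computation.\<close>

lemma ucomp_oracle_subst_code [ucomp_intros]:
  "ucomp G C \<Longrightarrow> ucomp G (\<lambda>g x. oracle_subst (C g x) d)"
  by (induction d) (auto intro: ucomp_intros)

section \<open>Initial segments\<close>

lemma length_initseg [simp]: "length (initseg g n) = n"
  by (simp add: initseg_def)

lemma nth_initseg [simp]: "i < n \<Longrightarrow> initseg g n ! i = g i"
  by (simp add: initseg_def)

lemma initseg_0 [simp]: "initseg g 0 = []"
  by (simp add: initseg_def)

lemma initseg_Suc: "initseg g (Suc n) = initseg g n @ [g n]"
  by (simp add: initseg_def)

lemma take_initseg [simp]: "take m (initseg g n) = initseg g (min m n)"
  by (simp add: initseg_def take_map min_def)

lemma prefix_initseg: "m \<le> n \<Longrightarrow> prefix (initseg g m) (initseg g n)"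
  by (metis min.absorb1 take_initseg take_is_prefix)

lemma prefix_initsegD: "prefix \<sigma> (initseg g n) \<Longrightarrow> \<sigma> = initseg g (length \<sigma>)"
  by (metis append_eq_conv_conj length_initseg min.absorb1 prefixE prefix_length_le take_initseg)

lemma set_initseg: "set (initseg g n) = g ` {..<n}"
  by (auto simp: initseg_def)

lemma drop_initseg: "drop m (initseg g n) = initseg (\<lambda>i. g (m + i)) (n - m)"
  by (simp add: list_eq_iff_nth_eq)

lemma map_initseg: "map f (initseg g n) = initseg (\<lambda>i. f (g i)) n"
  by (simp add: initseg_def)

section \<open>Certificates for computations\<close>

text \<open>
  A fact \<open>(e, x, y)\<close> asserts that the program \<open>e\<close> yields \<open>y\<close> on input \<open>x\<close>. It is justified by
  a set of facts when it follows from them by one clause of \<^const>\<open>run\<close>; only the values of the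
  oracle listed in \<open>\<sigma>\<close> may be used. The bounds on the subprograms make the notion decidable.
\<close>

definition justified :: "nat list \<Rightarrow> (code \<times> nat \<times> nat) set \<Rightarrow> code \<Rightarrow> nat \<Rightarrow> nat \<Rightarrow> bool" where
  "justified \<sigma> W e x y \<longleftrightarrow>
     e = CZero \<and> y = 0 \<or> e = CSucc \<and> y = Suc x \<or>
     e = CFst \<and> y = fst (prod_decode x) \<or> e = CSnd \<and> y = snd (prod_decode x) \<or>
     e = COracle \<and> x < length \<sigma> \<and> y = \<sigma> !! x \<or>
     (\<exists>c. enc c < enc e \<and>
       ((\<exists>d. enc d < enc e \<and>
          (e = CPair c d \<and> (c, x, fst (prod_decode y)) \<in> W \<and> (d, x, snd (prod_decode y)) \<in> W \<or>
           e = CComp c d \<and> (\<exists>f\<in>W. fst f = d \<and> fst (snd f) = x \<and> (c, snd (snd f), y) \<in> W) \<or>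
           e = CPrec c d \<and>
             (snd (prod_decode x) = 0 \<and> (c, fst (prod_decode x), y) \<in> W \<or>
              0 < snd (prod_decode x) \<and> (\<exists>f\<in>W. fst f = e \<and>
                fst (snd f) = prod_encode (fst (prod_decode x), snd (prod_decode x) - 1) \<and>
                (d, prod_encode (fst (prod_decode x),
                  prod_encode (snd (prod_decode x) - 1, snd (snd f))), y) \<in> W)))) \<or>
        e = CMin c \<and> (c, prod_encode (x, y), 0) \<in> W \<and>
          (\<forall>n<y. \<exists>f\<in>W. fst f = c \<and> fst (snd f) = prod_encode (x, n) \<and> 0 < snd (snd f))))"

text \<open>A fact may rely only on the facts behind it in the list. This excludes circular
  justification and lets certificates be joined by concatenation.\<close>

primrec cert :: "nat list \<Rightarrow> (code \<times> nat \<times> nat) list \<Rightarrow> bool" where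
  "cert \<sigma> [] \<longleftrightarrow> True"
| "cert \<sigma> (f # w) \<longleftrightarrow> justified \<sigma> (set w) (fst f) (fst (snd f)) (snd (snd f)) \<and> cert \<sigma> w"

lemma cert_iff:
  "cert \<sigma> w \<longleftrightarrow> (\<forall>k<length w. justified \<sigma> (set (drop (Suc k) w))
     (fst (w !! k)) (fst (snd (w !! k))) (snd (snd (w !! k))))"
  by (induction w) (simp_all add: nth0_def All_less_Suc2)

lemma udec_cert [ucomp_intros]:
  assumes "ucomp G S" and "ucomp G W"
  shows "udec G (\<lambda>g x. cert (S g x) (W g x))"
proof -
  have "udec G (\<lambda>g z. cert (fst z) (snd z))"
    unfolding cert_iff justified_def by (intro ucomp_intros)
  from udec_compose[OF this ucomp_Pair[OF assms]] show ?thesis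
    by simp
qed

lemma less_numeral_plus_prod_encode [simp]:
  shows "a < numeral k + 4 * prod_encode (a, b)" and "b < numeral k + 4 * prod_encode (a, b)"
proof -
  have "0 < (numeral k :: nat)" by simp
  with le_prod_encode_1[of a b] le_prod_encode_2[of b a]
  show "a < numeral k + 4 * prod_encode (a, b)" "b < numeral k + 4 * prod_encode (a, b)"
    by linarith+
qed

lemma justified_sound:
  assumes just: "justified \<sigma> W e x y" and \<sigma>: "\<sigma> = initseg g (length \<sigma>)"
    and W: "\<And>c u v. (c, u, v) \<in> W \<Longrightarrow> run g c u = Some v"
  shows "run g e x = Some y"
proof (cases e)
  case COracle
  then show ?thesis
    using just \<sigma> by (auto simp: justified_def initseg_def) (metis add_0 diff_zero nth_map_upt)
next
  case (CPair c d)
  then show ?thesis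
    using just by (auto simp: justified_def dest!: W)
next
  case (CComp c d)
  then show ?thesis
    using just by (auto simp: justified_def dest!: W)
next
  case (CPrec c d)
  obtain a n where x: "x = prod_encode (a, n)"
    by (metis prod.exhaust prod_decode_inverse)
  show ?thesis
  proof (cases n)
    case 0
    then show ?thesis
      using just CPrec x by (auto simp: justified_def dest!: W)
  next
    case (Suc m)
    then obtain z where "(e, prod_encode (a, m), z) \<in> W"
      and "(d, prod_encode (a, prod_encode (m, z)), y) \<in> W"
      using just CPrec x by (auto simp: justified_def)
    then show ?thesis
      using CPrec x Suc by (auto dest!: W)
  qed
next
  case (CMin c)
  then have c: "(c, prod_encode (x, y), 0) \<in> W"
    and before: "\<And>n. n < y \<Longrightarrow> \<exists>v>0. (c, prod_encode (x, n), v) \<in> W"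
    using just by (auto simp: justified_def) (metis prod.collapse)
  have y: "run g c (prod_encode (x, y)) = Some 0"
    using c by (rule W)
  have n: "\<exists>v>0. run g c (prod_encode (x, n)) = Some v" if "n < y" for n
    using before[OF that] W by blast
  have "(LEAST n. run g c (prod_encode (x, n)) = Some 0) = y"
    using y n by (intro Least_equality) (force intro: leI)+
  moreover have "\<exists>n. run g c (prod_encode (x, n)) = Some 0 \<and>
      (\<forall>m<n. run g c (prod_encode (x, m)) \<noteq> None)"
    using y n by force
  ultimately show ?thesis
    using CMin by simp
qed (use just in \<open>auto simp: justified_def\<close>)

lemma cert_sound:
  assumes "cert \<sigma> w" and "\<sigma> = initseg g (length \<sigma>)" and "(e, x, y) \<in> set w"
  shows "run g e x = Some y"
  using assms(1,3)
proof (induction w arbitrary: e x y)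
  case (Cons f w)
  from Cons.prems(1) have w: "cert \<sigma> w"
    and f: "justified \<sigma> (set w) (fst f) (fst (snd f)) (snd (snd f))"
    by simp_all
  show ?case
  proof (cases "(e, x, y) \<in> set w")
    case True
    with w show ?thesis by (rule Cons.IH)
  next
    case False
    with Cons.prems(2) have "f = (e, x, y)" by simp
    with justified_sound[OF f assms(2) Cons.IH[OF w]] show ?thesis by simp
  qed
qed simp

text \<open>The set \<open>W\<close> occurs only positively in \<open>justified\<close>, and a
  longer oracle string keeps the entries already present.\<close>

lemma justified_mono:
  assumes "justified \<sigma> W e x y" and "prefix \<sigma> \<sigma>'" and "W \<subseteq> W'"
  shows "justified \<sigma>' W' e x y"
proof -
  have W: "f \<in> W \<Longrightarrow> f \<in> W'" for f
    using assms(3) by blast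
  have \<sigma>: "x < length \<sigma>' \<and> y = \<sigma>' !! x" if "x < length \<sigma> \<and> y = \<sigma> !! x"
    using that assms(2) by (auto simp: prefix_def nth_append)
  have "justified \<sigma> W e x y \<longrightarrow> justified \<sigma> W' e x y"
    unfolding justified_def Bex_def
    by (intro disj_mono conj_mono ex_mono all_mono imp_mono imp_refl) (blast intro: W)+
  with assms(1) have "justified \<sigma> W' e x y" by blast
  then show ?thesis
    unfolding justified_def by (elim disj_forward) (assumption | use \<sigma> in blast)+
qed

lemma cert_append: "cert \<sigma> w \<Longrightarrow> cert \<sigma> v \<Longrightarrow> cert \<sigma> (w @ v)"
  by (induction w) (auto elim: justified_mono)

lemma cert_mono: "cert \<sigma> w \<Longrightarrow> prefix \<sigma> \<sigma>' \<Longrightarrow> cert \<sigma>' w"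
  by (induction w) (auto elim: justified_mono)

lemma cert_finite:
  assumes "finite F" and "\<And>f. f \<in> F \<Longrightarrow> \<exists>n w. cert (initseg g n) w \<and> f \<in> set w"
  shows "\<exists>n w. cert (initseg g n) w \<and> F \<subseteq> set w"
  using assms
proof (induction F)
  case empty
  show ?case by (intro exI[of _ 0] exI[of _ "[]"]) simp
next
  case (insert f F)
  obtain n w where w: "cert (initseg g n) w" "F \<subseteq> set w"
    using insert by (metis insertCI)
  obtain m v where v: "cert (initseg g m) v" "f \<in> set v"
    using insert.prems by blast
  have "cert (initseg g (max n m)) (w @ v)"
    using w v by (intro cert_append) (auto elim!: cert_mono intro: prefix_initseg)
  with w v show ?case
    by (intro exI[of _ "max n m"] exI[of _ "w @ v"]) auto
qed

text \<open>A halting computation queries only finitely much of the oracle. The set \<open>D\<close>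
  of certifiable facts is closed under justification from finitely many of its members, and the
  induction on the program follows the clauses of \<open>run\<close>.\<close>

lemma cert_complete:
  assumes "run g e x = Some y"
  shows "\<exists>n w. cert (initseg g n) w \<and> (e, x, y) \<in> set w"
proof -
  define D where "D = {f. \<exists>n w. cert (initseg g n) w \<and> f \<in> set w}"
  have D: "\<exists>n w. cert (initseg g n) w \<and> F \<subseteq> set w" if "finite F" "F \<subseteq> D" for F
    by (rule cert_finite) (use that in \<open>auto simp: D_def\<close>)
  have step: "(e, x, y) \<in> D" if F: "finite F" "F \<subseteq> D" and just: "justified (initseg g k) F e x y" for F k e x y
  proof -
    obtain n w where w: "cert (initseg g n) w" "F \<subseteq> set w"
      using D[OF F] by blast
    have "justified (initseg g (max n k)) (set w) e x y"
      using just w(2) by (auto elim!: justified_mono intro: prefix_initseg)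
    moreover have "cert (initseg g (max n k)) w"
      using w(1) by (rule cert_mono) (simp add: prefix_initseg)
    ultimately have "cert (initseg g (max n k)) ((e, x, y) # w)"
      by simp
    then show ?thesis
      unfolding D_def by (metis (mono_tags, lifting) list.set_intros(1) mem_Collect_eq)
  qed
  have "(e, x, y) \<in> D"
    using assms
  proof (induction e arbitrary: x y)
    case (CPair c d)
    then obtain u v where "run g c x = Some u" "run g d x = Some v" "y = prod_encode (u, v)"
      by (auto split: option.splits)
    with CPair.IH show ?case
      by (intro step[of "{(c, x, u), (d, x, v)}" 0]) (auto simp: justified_def)
  next
    case (CComp c d)
    then obtain u where "run g d x = Some u" "run g c u = Some y"
      by (auto split: option.splits)
    with CComp.IH show ?case
      by (intro step[of "{(d, x, u), (c, u, y)}" 0]) (auto simp: justified_def)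
  next
    case (CPrec c d)
    obtain a n where x: "x = prod_encode (a, n)"
      by (metis prod.exhaust prod_decode_inverse)
    have "(CPrec c d, prod_encode (a, n), y) \<in> D" if "run g (CPrec c d) (prod_encode (a, n)) = Some y" for n y
      using that
    proof (induction n arbitrary: y)
      case 0
      then have "run g c a = Some y" by simp
      with CPrec.IH show ?case
        by (intro step[of "{(c, a, y)}" 0]) (auto simp: justified_def)
    next
      case (Suc n)
      then obtain z where z: "run g (CPrec c d) (prod_encode (a, n)) = Some z"
        "run g d (prod_encode (a, prod_encode (n, z))) = Some y"
        by (auto split: option.splits)
      with Suc.IH CPrec.IH show ?case
        by (intro step[of "{(CPrec c d, prod_encode (a, n), z), (d, prod_encode (a, prod_encode (n, z)), y)}" 0])
          (auto simp: justified_def)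
    qed
    with CPrec.prems x show ?case by blast
  next
    case (CMin c)
    let ?R = "\<lambda>n. run g c (prod_encode (x, n))"
    have ex: "\<exists>n. ?R n = Some 0 \<and> (\<forall>m<n. ?R m \<noteq> None)" and y: "y = (LEAST n. ?R n = Some 0)"
      using CMin.prems by (auto split: if_splits)
    then obtain n where n: "?R n = Some 0" "\<forall>m<n. ?R m \<noteq> None" by blast
    have y0: "?R y = Some 0" and "y \<le> n"
      unfolding y using n(1) by (auto intro: LeastI Least_le)
    have "\<exists>v. ?R m = Some v \<and> 0 < v" if "m < y" for m
    proof -
      have "?R m \<noteq> Some 0" using that unfolding y by (rule not_less_Least)
      then show ?thesis using that n(2) \<open>y \<le> n\<close> by (metis less_le_trans neq0_conv not_Some_eq)
    qed
    then obtain v where v: "\<And>m. m < y \<Longrightarrow> ?R m = Some (v m) \<and> 0 < v m"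
      by metis
    let ?F = "insert (c, prod_encode (x, y), 0) ((\<lambda>m. (c, prod_encode (x, m), v m)) ` {..<y})"
    show ?case
      by (rule step[of ?F 0]) (use y0 v CMin.IH in \<open>auto simp: justified_def\<close>)
  next
    case COracle
    then show ?case
      by (intro step[of "{}" "Suc x"]) (auto simp: justified_def)
  qed (auto intro!: step[of "{}" 0] simp: justified_def)
  then show ?thesis
    unfolding D_def by blast
qed

lemma cert_complete_finite:
  assumes "finite F" and "\<And>e x y. (e, x, y) \<in> F \<Longrightarrow> run g e x = Some y"
  shows "\<exists>n w. cert (initseg g n) w \<and> F \<subseteq> set w"
proof (rule cert_finite[OF assms(1)])
  show "\<exists>n w. cert (initseg g n) w \<and> f \<in> set w" if "f \<in> F" for f
    using that assms(2) cert_complete by (metis prod.collapse)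
qed

text \<open>This is a universal machine: a search over triples of an output, an oracle length and a
  certificate. Completeness of certificates makes the search halt, soundness makes the output found
  the right one.\<close>

lemma ucomp_universal:
  fixes C :: "'a::encodable \<Rightarrow> code" and F :: "'a \<Rightarrow> 'b::encodable \<Rightarrow> 'c::encodable"
  assumes C: "ucomp UNIV (\<lambda>_. C)" and run: "\<And>g a x. run g (C a) (enc x) = Some (enc (F a x))"
  shows "ucomp UNIV (\<lambda>_ z. F (fst z) (snd z))"
proof -
  let ?ok = "\<lambda>g z N. case dec N of (y :: 'c, n :: nat, w :: (code \<times> nat \<times> nat) list) \<Rightarrow>
    cert (initseg g n) w \<and> (C (fst z), enc (snd z :: 'b), enc y) \<in> set w"
  have ex: "\<exists>N. ?ok g z N" for g and z :: "'a \<times> 'b"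
  proof -
    obtain n w where "cert (initseg g n) w" "(C (fst z), enc (snd z), enc (F (fst z) (snd z))) \<in> set w"
      using cert_complete[OF run[of g "fst z" "snd z"]] by blast
    then have "?ok g z (enc (F (fst z) (snd z), n, w))" by (simp del: enc_Pair)
    then show ?thesis ..
  qed
  have sound: "F (fst z) (snd z) = fst (dec N :: 'c \<times> nat \<times> (code \<times> nat \<times> nat) list)"
    if "?ok g z N" for g N and z :: "'a \<times> 'b"
  proof -
    obtain y n w where N: "dec N = (y :: 'c, n :: nat, w :: (code \<times> nat \<times> nat) list)" by (metis prod.exhaust)
    have "run g (C (fst z)) (enc (snd z)) = Some (enc y)"
      by (rule cert_sound[of "initseg g n" w]) (use that N in auto)
    with run N show ?thesis by simp
  qed
  have "ucomp UNIV (\<lambda>g z. LEAST N. ?ok g z N)"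
  proof (rule ucomp_Least)
    show "udec UNIV (\<lambda>g z. ?ok g (fst z) (snd z))"
      by (intro ucomp_intros ucomp_compose[OF C])
    show "\<exists>N. ?ok g z N" for g and z :: "'a \<times> 'b"
      by (rule ex)
  qed
  then have "ucomp UNIV (\<lambda>g z. fst (dec (LEAST N. ?ok g z N) :: 'c \<times> nat \<times> (code \<times> nat \<times> nat) list))"
    by (intro ucomp_intros)
  then show ?thesis
  proof (rule ucomp_cong)
    show "fst (dec (LEAST N. ?ok g z N) :: 'c \<times> nat \<times> (code \<times> nat \<times> nat) list) = F (fst z) (snd z)"
      for g and z :: "'a \<times> 'b"
      using sound[OF LeastI_ex[OF ex]] by simp
  qed
qed

section \<open>Trees, paths and limits of strings\<close>

definition paths :: "(nat list \<Rightarrow> bool) \<Rightarrow> (nat \<Rightarrow> nat) set" where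
  "paths T = {g. \<forall>n. T (initseg g n)}"

definition tree :: "(nat list \<Rightarrow> bool) \<Rightarrow> bool" where
  "tree T \<longleftrightarrow> (\<forall>\<sigma> \<tau>. prefix \<sigma> \<tau> \<longrightarrow> T \<tau> \<longrightarrow> T \<sigma>)"

lemma treeD: "tree T \<Longrightarrow> T \<tau> \<Longrightarrow> prefix \<sigma> \<tau> \<Longrightarrow> T \<sigma>"
  by (auto simp: tree_def)

lemma pathsI: "(\<And>n. T (initseg g n)) \<Longrightarrow> g \<in> paths T"
  by (simp add: paths_def)

lemma pathsD: "g \<in> paths T \<Longrightarrow> T (initseg g n)"
  by (simp add: paths_def)

lemma pathsI_cofinal:
  assumes "tree T" and "\<And>n. \<exists>m\<ge>n. T (initseg g m)"
  shows "g \<in> paths T"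
  using assms by (meson pathsI prefix_initseg treeD)

lemma ex_limit:
  assumes "\<And>n. prefix (s n) (s (Suc n))" and len: "\<And>n. n \<le> length (s n)"
  shows "\<exists>g. \<forall>n. s n = initseg g (length (s n))"
proof -
  have mono: "prefix (s m) (s n)" if "m \<le> n" for m n
    using that by (induction n rule: dec_induct) (auto intro: assms(1) prefix_order.trans)
  have "s n = initseg (\<lambda>i. s (Suc i) ! i) (length (s n))" for n
  proof (rule nth_equalityI)
    fix i assume i: "i < length (s n)"
    have i': "i < length (s (Suc i))" using len[of "Suc i"] by simp
    have "prefix (s n) (s (Suc i)) \<or> prefix (s (Suc i)) (s n)"
      using mono nat_le_linear by blast
    then have "s n ! i = s (Suc i) ! i"
      using i i' by (auto simp: prefix_def nth_append)
    with i show "s n ! i = initseg (\<lambda>i. s (Suc i) ! i) (length (s n)) ! i" by simp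
  qed simp
  then show ?thesis by blast
qed

lemma filterlim_plus_nat: "filterlim (\<lambda>n. k + n :: nat) at_top sequentially"
  by (auto intro!: filterlim_subseq strict_monoI)

definition prepend :: "nat list \<Rightarrow> (nat \<Rightarrow> nat) \<Rightarrow> nat \<Rightarrow> nat" where
  "prepend \<sigma> g n = (if n < length \<sigma> then \<sigma> !! n else g (n - length \<sigma>))"

lemma initseg_prepend: "initseg (prepend \<sigma> g) (length \<sigma> + n) = \<sigma> @ initseg g n"
  by (rule nth_equalityI) (auto simp: prepend_def nth_append)

lemma initseg_add: "initseg (\<lambda>n. k + g n) n = map ((+) k) (initseg g n)"
  by (simp add: initseg_def)

lemma prepend_in_pathsI:
  assumes "tree T" and "\<And>n. T (\<sigma> @ initseg g n)"
  shows "prepend \<sigma> g \<in> paths T"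
proof (rule pathsI_cofinal[OF assms(1)])
  show "\<exists>m\<ge>n. T (initseg (prepend \<sigma> g) m)" for n
    using assms(2)[of n] by (intro exI[of _ "length \<sigma> + n"]) (simp add: initseg_prepend)
qed

section \<open>Defeating finitely many learners\<close>

text \<open>
  Learners output programs instead of indices, and they need not be computable.
\<close>

definition succeeds :: "(nat \<Rightarrow> nat) set \<Rightarrow> (nat list \<Rightarrow> code) \<Rightarrow> (nat \<Rightarrow> nat) \<Rightarrow> bool" where
  "succeeds Q \<Psi> g \<longleftrightarrow> (\<exists>c. (\<forall>\<^sub>F n in sequentially. \<Psi> (initseg g n) = c) \<and>
     (\<exists>f\<in>Q. \<forall>x. run g c x = Some (f x)))"

text \<open>For \<open>n = 0\<close> this only says that \<open>S\<close> is nonempty, which starts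
  the induction. As learners are arbitrary functions, they may be pulled back along any map of
  strings.\<close>

definition defeats :: "(nat \<Rightarrow> nat) set \<Rightarrow> nat \<Rightarrow> (nat \<Rightarrow> nat) set \<Rightarrow> bool" where
  "defeats Q n S \<longleftrightarrow>
     (\<forall>L. finite L \<and> card L \<le> n \<longrightarrow> (\<exists>g\<in>S. \<forall>\<Psi>\<in>L. \<not> succeeds Q \<Psi> g))"

text \<open>The pulled back learner translates the part of \<open>p\<close> seen so far into a part
  of \<open>g\<close>, asks \<open>\<Psi>\<close>, and replaces the oracle in the answer by the
  program \<open>c\<close>, which computes \<open>g\<close> from \<open>p\<close>. As
  \<open>k\<close> tends to infinity, convergence is inherited.\<close>

lemma succeeds_transfer:
  assumes c: "\<And>n. run p c n = Some (g n)"
    and \<theta>: "\<And>n. \<theta> (initseg p n) = initseg g (k n)" and k: "filterlim k at_top sequentially"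
    and succ: "succeeds Q \<Psi> g"
  shows "succeeds Q (\<lambda>\<rho>. oracle_subst c (\<Psi> (\<theta> \<rho>))) p"
proof -
  obtain d f where d: "\<forall>\<^sub>F n in sequentially. \<Psi> (initseg g n) = d"
    and f: "f \<in> Q" "\<forall>x. run g d x = Some (f x)"
    using succ unfolding succeeds_def by blast
  have "\<forall>\<^sub>F n in sequentially. \<Psi> (initseg g (k n)) = d"
    using eventually_compose_filterlim[OF d k] .
  then have "\<forall>\<^sub>F n in sequentially. oracle_subst c (\<Psi> (\<theta> (initseg p n))) = oracle_subst c d"
    by eventually_elim (simp add: \<theta>)
  with f show ?thesis
    unfolding succeeds_def by (metis run_oracle_subst[OF c])
qed

text \<open>Pulling back the learners in \<open>L\<close> gives at most as many learners; an element
  of \<open>S\<close> that defeats these is mapped by \<open>G\<close> to one that defeats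
  \<open>L\<close>.\<close>

lemma defeats_transfer:
  assumes S: "defeats Q n S" and G: "ucomp UNIV G"
    and \<theta>: "\<And>p n. \<theta> (initseg p n) = initseg (G p) (k n)" and k: "filterlim k at_top sequentially"
    and GS: "\<And>p. p \<in> S \<Longrightarrow> G p \<in> S'"
  shows "defeats Q n S'"
  unfolding defeats_def
proof (intro allI impI)
  fix L :: "(nat list \<Rightarrow> code) set"
  assume L: "finite L \<and> card L \<le> n"
  obtain c where c: "\<And>p n. run p c n = Some (G p n)"
    using G unfolding ucomp_def by auto
  let ?t = "\<lambda>\<Psi> \<rho>. oracle_subst c (\<Psi> (\<theta> \<rho>))"
  have "finite (?t ` L) \<and> card (?t ` L) \<le> n"
    using L card_image_le le_trans by blast
  then obtain p where "p \<in> S" and p: "\<forall>\<Psi>\<in>?t ` L. \<not> succeeds Q \<Psi> p"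
    using S unfolding defeats_def by blast
  have "\<not> succeeds Q \<Psi> (G p)" if "\<Psi> \<in> L" for \<Psi>
    using succeeds_transfer[of p c "G p", OF c \<theta> k] p that by blast
  with GS[OF \<open>p \<in> S\<close>] show "\<exists>g\<in>S'. \<forall>\<Psi>\<in>L. \<not> succeeds Q \<Psi> g"
    by blast
qed

section \<open>Guarded hyperconcatenation\<close>

text \<open>
  In the strings below the symbol \<open>s + 3\<close> stands for the symbol \<open>s\<close> of the given tree \<open>T\<close>, and the
  symbols \<open>0\<close>, \<open>1\<close>, \<open>2\<close> abandon the current block, after which a new string of \<open>T\<close> is begun.
  The symbols \<open>1\<close> and \<open>2\<close> also code one more bit of an element of \<open>P\<close>. The symbol \<open>0\<close> codes nothing.
\<close>

definition coded :: "nat list \<Rightarrow> nat list" where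
  "coded \<sigma> = map (\<lambda>a. a - 1) (filter (\<lambda>a. a = 1 \<or> a = 2) \<sigma>)"

definition block :: "nat list \<Rightarrow> nat list" where
  "block \<sigma> = foldl (\<lambda>r a. if 3 \<le> a then r @ [a - 3] else []) [] \<sigma>"

text \<open>This is what precedes the current block; it is empty or ends with a symbol that abandons
  a block.\<close>

definition base :: "nat list \<Rightarrow> nat list" where
  "base \<sigma> = take (length \<sigma> - length (block \<sigma>)) \<sigma>"

abbreviation lift3 :: "nat list \<Rightarrow> nat list" where
  "lift3 \<equiv> map ((+) 3)"

lemma coded_Nil [simp]: "coded [] = []"
  by (simp add: coded_def)

lemma coded_append [simp]: "coded (\<sigma> @ \<tau>) = coded \<sigma> @ coded \<tau>"
  by (simp add: coded_def)

lemma coded_single [simp]: "coded [a] = (if a = 1 \<or> a = 2 then [a - 1] else [])"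
  by (simp add: coded_def)

lemma coded_lift3 [simp]: "coded (lift3 \<rho>) = []"
  by (auto simp: coded_def filter_empty_conv)

lemma prefix_coded: "prefix \<sigma> \<tau> \<Longrightarrow> prefix (coded \<sigma>) (coded \<tau>)"
  by (auto simp: prefix_def)

lemma block_Nil [simp]: "block [] = []"
  by (simp add: block_def)

lemma block_snoc [simp]: "block (\<sigma> @ [a]) = (if 3 \<le> a then block \<sigma> @ [a - 3] else [])"
  by (simp add: block_def)

lemma block_lift3 [simp]: "block (\<sigma> @ lift3 \<rho>) = block \<sigma> @ \<rho>"
proof (induction \<rho> rule: rev_induct)
  case (snoc a \<rho>)
  then show ?case
    using block_snoc[of "\<sigma> @ lift3 \<rho>" "3 + a"] by simp
qed simp

lemma base_append_block: "\<sigma> = base \<sigma> @ lift3 (block \<sigma>)"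
proof -
  have "\<exists>\<beta>. \<sigma> = \<beta> @ lift3 (block \<sigma>)"
  proof (induction \<sigma> rule: rev_induct)
    case (snoc a \<sigma>)
    then obtain \<beta> where "\<sigma> = \<beta> @ lift3 (block \<sigma>)" ..
    then show ?case
      by (cases "3 \<le> a") (auto intro: exI[of _ \<beta>] exI[of _ "\<sigma> @ [a]"])
  qed simp
  then obtain \<beta> where \<beta>: "\<sigma> = \<beta> @ lift3 (block \<sigma>)" ..
  then have "length \<sigma> = length \<beta> + length (block \<sigma>)"
    by (metis length_append length_map)
  then have "base \<sigma> = \<beta>"
    unfolding base_def by (metis \<beta> add_diff_cancel_right' append_eq_conv_conj)
  with \<beta> show ?thesis by simp
qed

lemma prefix_base: "prefix (base \<sigma>) \<sigma>"
  by (metis base_append_block prefixI)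

lemma block_base [simp]: "block (base \<sigma>) = []"
  by (metis append_self_conv2 base_append_block block_lift3)

lemma coded_base [simp]: "coded (base \<sigma>) = coded \<sigma>"
  by (metis append_Nil2 base_append_block coded_append coded_lift3)

lemma base_eq: "block \<sigma> = [] \<Longrightarrow> base \<sigma> = \<sigma>"
  by (simp add: base_def)

lemma base_lift3: "block \<sigma> = [] \<Longrightarrow> base (\<sigma> @ lift3 \<rho>) = \<sigma>"
  by (simp add: base_def)

text \<open>A string with empty block is empty or ends with a symbol below 3, and no such symbol of
  \<open>\<sigma>\<close> comes after \<open>base \<sigma>\<close>.\<close>

lemma prefix_base_iff: "prefix \<tau> \<sigma> \<Longrightarrow> block \<tau> = [] \<Longrightarrow> prefix \<tau> (base \<sigma>)"
proof (induction \<sigma> rule: rev_induct)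
  case (snoc a \<sigma>)
  show ?case
  proof (cases "\<tau> = \<sigma> @ [a] \<or> a < 3")
    case True
    with snoc.prems show ?thesis by (auto simp: base_eq)
  next
    case False
    with snoc have "prefix \<tau> (base \<sigma>)" by simp
    moreover have "prefix (base \<sigma>) (base (\<sigma> @ [a]))"
      using False by (simp add: base_def)
    ultimately show ?thesis by (rule prefix_order.trans)
  qed
qed (simp add: base_eq)

locale pi01_pair =
  fixes P Q :: "(nat \<Rightarrow> nat) set" and TP TQ :: "nat list \<Rightarrow> bool"
  assumes P_eq: "P = paths TP" and Q_eq: "Q = paths TQ"
    and tree_TP: "tree TP" and tree_TQ: "tree TQ"
    and udec_TP: "udec UNIV (\<lambda>_. TP)" and udec_TQ: "udec UNIV (\<lambda>_. TQ)"
    and binary_TP: "TP \<sigma> \<Longrightarrow> a \<in> set \<sigma> \<Longrightarrow> a \<le> 1"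
    and P_nonempty: "P \<noteq> {}" and Q_not_computable: "f \<in> Q \<Longrightarrow> \<not> computable f"
begin

lemma TP_Nil: "TP []"
  using P_nonempty pathsD[of _ TP 0] by (auto simp: P_eq)

text \<open>The number of coded bits is read as a pair whose first component names a program. Every
  program is thus named by arbitrarily large counts, and free steps keep the target because they
  code nothing.\<close>

definition target :: "nat list \<Rightarrow> code" where
  "target \<beta> = dec (fst (prod_decode (length (coded \<beta>))))"

text \<open>
  The block \<open>\<rho>\<close> is evidence that the program under attack computes, from an oracle extending
  \<open>\<beta>\<close>, a string of \<open>TQ\<close> that is as long as \<open>\<beta>\<close>.
\<close>

definition progress :: "nat list \<Rightarrow> nat list \<Rightarrow> bool" where
  "progress \<beta> \<rho> \<longleftrightarrow> (\<exists>z. enc z < length \<rho> \<and> (case z of (ys, w) \<Rightarrow>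
     length ys = length \<beta> \<and> TQ ys \<and> cert (\<beta> @ lift3 \<rho>) w \<and>
     (\<forall>i<length \<beta>. (target \<beta>, i, ys !! i) \<in> set w)))"

text \<open>
  Only the first block that makes progress may be abandoned without coding a bit. Infinitely many
  such steps in a row would thus follow a computable path and yield a computable element of \<open>Q\<close>.
\<close>

definition adopted :: "(nat list \<Rightarrow> bool) \<Rightarrow> nat list \<Rightarrow> nat list \<Rightarrow> bool" where
  "adopted T \<beta> \<rho> \<longleftrightarrow> (T \<rho> \<and> progress \<beta> \<rho>) \<and> (\<forall>\<rho>'. enc \<rho>' < enc \<rho> \<longrightarrow> \<not> (T \<rho>' \<and> progress \<beta> \<rho>'))"

definition allowed :: "(nat list \<Rightarrow> bool) \<Rightarrow> nat list \<Rightarrow> nat \<Rightarrow> bool" where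
  "allowed T \<sigma> a \<longleftrightarrow> (if 3 \<le> a then T (block \<sigma> @ [a - 3])
     else if a = 0 then adopted T (base \<sigma>) (block \<sigma>) else TP (coded \<sigma> @ [a - 1]))"

definition hyper :: "(nat list \<Rightarrow> bool) \<Rightarrow> nat list \<Rightarrow> bool" where
  "hyper T \<sigma> \<longleftrightarrow> (\<forall>m<length \<sigma>. allowed T (take m \<sigma>) (\<sigma> !! m))"

section \<open>Decidability and basic properties of the guarded tree\<close>

lemma ucomp_coded [ucomp_intros]: "ucomp G A \<Longrightarrow> ucomp G (\<lambda>g x. coded (A g x))"
  unfolding coded_def by (intro ucomp_intros)

lemma ucomp_block [ucomp_intros]: "ucomp G A \<Longrightarrow> ucomp G (\<lambda>g x. block (A g x))"
  unfolding block_def by (intro ucomp_intros)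

lemma ucomp_base [ucomp_intros]: "ucomp G A \<Longrightarrow> ucomp G (\<lambda>g x. base (A g x))"
  unfolding base_def by (intro ucomp_intros)

lemma udec_TP' [ucomp_intros]: "ucomp G A \<Longrightarrow> udec G (\<lambda>g x. TP (A g x))"
  by (rule udec_compose[OF udec_mono[OF udec_TP]]) auto

lemma udec_TQ' [ucomp_intros]: "ucomp G A \<Longrightarrow> udec G (\<lambda>g x. TQ (A g x))"
  by (rule udec_compose[OF udec_mono[OF udec_TQ]]) auto

lemma udec_progress:
  assumes "ucomp G A" and "ucomp G B"
  shows "udec G (\<lambda>g x. progress (A g x) (B g x))"
proof -
  have "udec G (\<lambda>g z. progress (fst z) (snd z))"
    unfolding progress_def target_def by (intro ucomp_intros)
  from udec_compose[OF this ucomp_Pair[OF assms]] show ?thesis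
    by simp
qed

text \<open>The tree may depend on the oracle: \<open>udec_level_uniform\<close> applies this with
  an oracle that holds the tree of the previous level.\<close>

lemma udec_hyper:
  assumes T: "udec G (\<lambda>g. T g)" and A: "ucomp G A"
  shows "udec G (\<lambda>g x. hyper (T g) (A g x))"
proof -
  note intros = ucomp_intros udec_compose[OF T] udec_progress
  have "udec G (\<lambda>g z. adopted (T g) (fst z) (snd z))"
    unfolding adopted_def by (intro intros)
  note adopted = udec_compose[OF this ucomp_Pair, simplified]
  have "udec G (\<lambda>g z. allowed (T g) (fst z) (snd z))"
    unfolding allowed_def by (intro intros adopted)
  note allowed = udec_compose[OF this ucomp_Pair, simplified]
  have "udec G (\<lambda>g. hyper (T g))"
    unfolding hyper_def by (intro intros allowed)
  from udec_compose[OF this A] show ?thesis .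
qed

lemma hyper_Nil [simp]: "hyper T []"
  by (simp add: hyper_def)

lemma hyper_snoc [simp]: "hyper T (\<sigma> @ [a]) \<longleftrightarrow> hyper T \<sigma> \<and> allowed T \<sigma> a"
  by (auto simp: hyper_def less_Suc_eq nth_append)

lemma hyper_appendD: "hyper T (\<sigma> @ \<tau>) \<Longrightarrow> hyper T \<sigma>"
  by (induction \<tau> rule: rev_induct) (simp_all del: append_assoc add: append_assoc[symmetric])

lemma tree_hyper: "tree (hyper T)"
  unfolding tree_def by (auto simp: prefix_def dest: hyper_appendD)

text \<open>Symbols from 3 on are tested against \<open>T\<close> alone, so a full copy of
  \<open>T\<close> lies above every string of the tree whose block is empty.\<close>

lemma hyper_lift3:
  assumes "tree T" and "hyper T \<sigma>" and "block \<sigma> = []" and "T \<rho>"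
  shows "hyper T (\<sigma> @ lift3 \<rho>)"
  using \<open>T \<rho>\<close>
proof (induction \<rho> rule: rev_induct)
  case Nil
  then show ?case using assms by simp
next
  case (snoc a \<rho>)
  then have "hyper T (\<sigma> @ lift3 \<rho>)"
    using assms(1) by (meson prefixI treeD)
  moreover have "allowed T (\<sigma> @ lift3 \<rho>) (3 + a)"
    using snoc.prems assms(3) by (simp add: allowed_def)
  ultimately show ?case
    using hyper_snoc[of T "\<sigma> @ lift3 \<rho>" "3 + a"] by simp
qed

lemma hyper_adopted:
  assumes "tree T" and "hyper T \<sigma>" and "block \<sigma> = []" and "adopted T \<sigma> \<rho>"
  shows "hyper T ((\<sigma> @ lift3 \<rho>) @ [0])"
  using assms hyper_lift3[OF assms(1-3), of \<rho>]
  by (simp add: adopted_def allowed_def base_lift3 del: append_assoc)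

lemma TP_coded: "hyper T \<sigma> \<Longrightarrow> TP (coded \<sigma>)"
proof (induction \<sigma> rule: rev_induct)
  case (snoc a \<sigma>)
  then show ?case
    by (cases "a = 1 \<or> a = 2") (auto simp: allowed_def)
qed (simp add: TP_Nil)

lemma hyper_bounded:
  assumes "\<And>\<rho> a. T \<rho> \<Longrightarrow> a \<in> set \<rho> \<Longrightarrow> a \<le> B" and "hyper T \<sigma>" and "a \<in> set \<sigma>"
  shows "a \<le> B + 3"
  using assms(2,3)
proof (induction \<sigma> rule: rev_induct)
  case (snoc b \<sigma>)
  have "b \<le> B + 3"
  proof (cases "3 \<le> b")
    case True
    with snoc.prems(1) have "T (block \<sigma> @ [b - 3])" by (simp add: allowed_def)
    with assms(1) have "b - 3 \<le> B" by simp
    then show ?thesis by simp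
  qed simp
  with snoc show ?case by auto
qed simp

subsection \<open>Steps that code nothing\<close>

text \<open>For \<open>\<tau>\<close> in the tree with empty block, these are the strings reached
  from \<open>\<tau>\<close> by free steps alone. The target is the same on all of them.\<close>

definition chain :: "(nat list \<Rightarrow> bool) \<Rightarrow> nat list \<Rightarrow> nat list set" where
  "chain T \<tau> = {\<sigma>. hyper T \<sigma> \<and> prefix \<tau> \<sigma> \<and> length (coded \<sigma>) = length (coded \<tau>) \<and> block \<sigma> = []}"

definition adoption :: "(nat list \<Rightarrow> bool) \<Rightarrow> (nat list \<times> nat list) set" where
  "adoption T = {(\<beta>, \<beta> @ lift3 \<rho> @ [0]) | \<beta> \<rho>. adopted T \<beta> \<rho>}"

lemma adopted_unique: "adopted T \<beta> \<rho> \<Longrightarrow> adopted T \<beta> \<rho>' \<Longrightarrow> \<rho> = \<rho>'"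
  unfolding adopted_def by (metis enc_eq_iff nat_neq_iff)

lemma single_valued_adoption: "single_valued (adoption T)"
  unfolding single_valued_def adoption_def using adopted_unique by blast

lemma adoption_prefix: "(\<beta>, \<sigma>) \<in> (adoption T)\<^sup>* \<Longrightarrow> prefix \<beta> \<sigma>"
proof (induction rule: rtrancl_induct)
  case (step \<sigma> \<sigma>')
  then show ?case
    by (auto simp: adoption_def intro: prefix_order.trans)
qed simp

text \<open>If \<open>\<sigma>\<close> differs from \<open>\<tau>\<close>, its last symbol is below
  3, as the block is empty, and codes no bit, as the count has not grown. So it is 0 and abandons an
  adopted block, in front of which a shorter member of the chain ends.\<close>

lemma chain_adoption:
  assumes "block \<tau> = []" and "\<sigma> \<in> chain T \<tau>"
  shows "(\<tau>, \<sigma>) \<in> (adoption T)\<^sup>*"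
  using assms(2)
proof (induction \<sigma> rule: measure_induct_rule[of length])
  case (less \<sigma>)
  show ?case
  proof (cases "\<sigma> = \<tau>")
    case False
    then obtain \<pi> a where \<sigma>: "\<sigma> = \<pi> @ [a]"
      using less.prems by (cases \<sigma> rule: rev_cases) (auto simp: chain_def)
    then have \<pi>: "prefix \<tau> \<pi>" "hyper T \<pi>" "allowed T \<pi> a" "a < 3"
      using less.prems False by (auto simp: chain_def split: if_splits)
    have "length (coded \<tau>) \<le> length (coded \<pi>)"
      using \<pi>(1) by (intro prefix_length_le prefix_coded)
    then have a: "a = 0" and len: "length (coded \<pi>) = length (coded \<tau>)"
      using less.prems \<pi>(4) by (auto simp: chain_def \<sigma> split: if_splits)
    then have "adopted T (base \<pi>) (block \<pi>)"
      using \<pi>(3) by (simp add: allowed_def)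
    then have "(base \<pi>, base \<pi> @ lift3 (block \<pi>) @ [0]) \<in> adoption T"
      by (auto simp: adoption_def)
    moreover have "base \<pi> @ lift3 (block \<pi>) @ [0] = \<sigma>"
      by (metis \<sigma> a append_assoc base_append_block)
    moreover have "base \<pi> \<in> chain T \<tau>"
      using \<pi> len assms(1) treeD[OF tree_hyper _ prefix_base] by (auto simp: chain_def prefix_base_iff)
    moreover have "length (base \<pi>) < length \<sigma>"
      using prefix_length_le[OF prefix_base, of \<pi>] by (simp add: \<sigma>)
    ultimately show ?thesis
      using less.IH by (metis rtrancl.rtrancl_into_rtrancl)
  qed simp
qed

text \<open>Free steps are deterministic, so two strings reached from \<open>\<tau>\<close> lie on
  one line of steps.\<close>

lemma chain_comparable:
  assumes "block \<tau> = []" and "\<sigma> \<in> chain T \<tau>" and "\<sigma>' \<in> chain T \<tau>"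
  shows "(\<sigma>, \<sigma>') \<in> (adoption T)\<^sup>* \<or> (\<sigma>', \<sigma>) \<in> (adoption T)\<^sup>*"
  using assms chain_adoption by (intro single_valued_confluent[OF single_valued_adoption])

lemma chain_step:
  assumes "block \<tau> = []" and "\<sigma> \<in> chain T \<tau>" and "\<sigma>' \<in> chain T \<tau>" and "length \<sigma> < length \<sigma>'"
  obtains \<rho> where "adopted T \<sigma> \<rho>" and "prefix (\<sigma> @ lift3 \<rho>) \<sigma>'"
proof -
  have "(\<sigma>, \<sigma>') \<in> (adoption T)\<^sup>*"
    using chain_comparable[OF assms(1-3)] assms(4) by (auto dest!: adoption_prefix prefix_length_le)
  then obtain \<sigma>'' where "(\<sigma>, \<sigma>'') \<in> adoption T" and "(\<sigma>'', \<sigma>') \<in> (adoption T)\<^sup>*"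
    using assms(4) by (metis converse_rtranclE less_irrefl)
  moreover from this obtain \<rho> where \<rho>: "adopted T \<sigma> \<rho>" "\<sigma>'' = (\<sigma> @ lift3 \<rho>) @ [0]"
    by (auto simp: adoption_def)
  ultimately have "prefix (\<sigma> @ lift3 \<rho>) \<sigma>'"
    using adoption_prefix append_prefixD by metis
  with \<rho>(1) show thesis by (rule that)
qed

lemma chain_prefix:
  assumes "block \<tau> = []" and "\<sigma> \<in> chain T \<tau>" and "\<sigma>' \<in> chain T \<tau>"
  shows "prefix \<sigma> \<sigma>' \<or> prefix \<sigma>' \<sigma>"
  using chain_comparable[OF assms] by (blast dest: adoption_prefix)

text \<open>An unbounded chain would have a computable union \<open>g\<close>. Each of its steps
  certifies that the program \<open>target \<tau>\<close> computes from \<open>g\<close> a longer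
  string of \<open>TQ\<close>, and the limit of these strings would be a computable element of
  \<open>Q\<close>.\<close>

lemma chain_bounded:
  assumes T: "udec UNIV (\<lambda>_. T)" and "block \<tau> = []"
  shows "\<exists>n. \<forall>\<sigma>\<in>chain T \<tau>. length \<sigma> \<le> n"
proof (rule ccontr)
  assume "\<not> ?thesis"
  then have unbounded: "\<exists>\<sigma>\<in>chain T \<tau>. n < length \<sigma>" for n
    by (metis not_le)
  \<comment> \<open>Members of the chain are comparable, so any one longer than \<open>n\<close> has
    the right symbol at \<open>n\<close>. The first is found by search, the chain being
    decidable.\<close>
  define g where "g n = (dec (LEAST N. (dec N :: nat list) \<in> chain T \<tau> \<and> n < length (dec N :: nat list)) :: nat list) !! n" for n
  have ex: "\<exists>N. (dec N :: nat list) \<in> chain T \<tau> \<and> n < length (dec N :: nat list)" for n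
    using unbounded[of n] by (metis dec_enc)
  have udec_chain: "udec UNIV (\<lambda>_ \<sigma>. \<sigma> \<in> chain T \<tau>)"
  proof -
    have "udec UNIV (\<lambda>_ \<sigma>. hyper T \<sigma> \<and> take (length \<tau>) \<sigma> = \<tau> \<and>
        length (coded \<sigma>) = length (coded \<tau>) \<and> block \<sigma> = [])"
      by (intro ucomp_intros udec_hyper T)
    moreover have "take (length \<tau>) \<sigma> = \<tau> \<longleftrightarrow> prefix \<tau> \<sigma>" for \<sigma>
      by (metis append_eq_conv_conj prefixE take_is_prefix)
    ultimately show ?thesis
      by (simp add: chain_def)
  qed
  have "ucomp UNIV (\<lambda>_. g)"
    unfolding g_def by (intro ucomp_intros ucomp_Least udec_compose[OF udec_chain] ex)
  then have g: "computable g"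
    by (simp add: computable_iff_ucomp)
  have chain_g: "\<sigma> = initseg g (length \<sigma>)" if \<sigma>: "\<sigma> \<in> chain T \<tau>" for \<sigma>
  proof (rule nth_equalityI)
    fix i assume i: "i < length \<sigma>"
    obtain \<sigma>' where \<sigma>': "\<sigma>' \<in> chain T \<tau>" "i < length \<sigma>'" "g i = \<sigma>' ! i"
      using LeastI_ex[OF ex[of i]] unfolding g_def by fastforce
    then show "\<sigma> ! i = initseg g (length \<sigma>) ! i"
      using chain_prefix[OF assms(2) \<sigma> \<sigma>'(1)] i by (auto simp: prefix_def nth_append)
  qed simp
  let ?e = "target \<tau>"
  have key: "\<exists>ys. n < length ys \<and> TQ ys \<and> (\<forall>i<length ys. run g ?e i = Some (ys ! i))" for n
  proof -
    obtain \<sigma> where \<sigma>: "\<sigma> \<in> chain T \<tau>" "n < length \<sigma>"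
      using unbounded by blast
    obtain \<sigma>' where \<sigma>': "\<sigma>' \<in> chain T \<tau>" "length \<sigma> < length \<sigma>'"
      using unbounded by blast
    obtain \<rho> where \<rho>: "adopted T \<sigma> \<rho>" "prefix (\<sigma> @ lift3 \<rho>) \<sigma>'"
      using chain_step[OF assms(2) \<sigma>(1) \<sigma>'] .
    \<comment> \<open>The certificate uses \<open>\<sigma> @ lift3 \<rho>\<close> as oracle string.
      This is an initial segment of \<open>g\<close> because the longer member
      \<open>\<sigma>'\<close> extends it.\<close>
    have seg: "\<sigma> @ lift3 \<rho> = initseg g (length (\<sigma> @ lift3 \<rho>))"
      using \<rho>(2) chain_g[OF \<sigma>'(1)] by (metis prefix_initsegD)
    have "target \<sigma> = ?e"
      using \<sigma>(1) by (simp add: target_def chain_def)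
    then obtain ys w where ys: "length ys = length \<sigma>" "TQ ys" "cert (\<sigma> @ lift3 \<rho>) w"
      "\<forall>i<length \<sigma>. (?e, i, ys !! i) \<in> set w"
      using \<rho>(1) unfolding adopted_def progress_def by auto
    then have "\<forall>i<length ys. run g ?e i = Some (ys ! i)"
      using cert_sound[OF ys(3) seg] by (metis nth0_eq_nth)
    with ys \<sigma>(2) show ?thesis by (intro exI[of _ ys]) auto
  qed
  define f where "f i = the (run g ?e i)" for i
  have run_f: "run g ?e i = Some (f i)" for i
    using key[of i] unfolding f_def by force
  have "f \<in> Q"
    unfolding Q_eq
  proof (rule pathsI_cofinal[OF tree_TQ])
    fix n
    obtain ys where ys: "n < length ys" "TQ ys" "\<forall>i<length ys. run g ?e i = Some (ys ! i)"
      using key by blast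
    then have "ys = initseg f (length ys)"
      by (intro nth_equalityI) (auto simp: run_f)
    with ys show "\<exists>m\<ge>n. TQ (initseg f m)"
      by (metis less_imp_le)
  qed
  moreover have "f \<le>\<^sub>T g"
    unfolding turing_le_def using run_f by blast
  with g have "computable f"
    unfolding computable_def by (rule turing_le_trans[rotated])
  ultimately show False
    using Q_not_computable by blast
qed

text \<open>Take a longest member of the chain. If some block made progress there, the one of least
  code would be adopted, and abandoning it would lengthen the chain.\<close>

lemma ex_stuck:
  assumes "udec UNIV (\<lambda>_. T)" and "tree T" and "hyper T \<tau>" and "block \<tau> = []"
  obtains \<sigma> where "\<sigma> \<in> chain T \<tau>" and "\<And>\<rho>. T \<rho> \<Longrightarrow> \<not> progress \<sigma> \<rho>"
proof -
  have "\<tau> \<in> chain T \<tau>"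
    using assms by (simp add: chain_def)
  moreover obtain n where "\<forall>\<sigma>. \<sigma> \<in> chain T \<tau> \<longrightarrow> length \<sigma> < Suc n"
    using chain_bounded[OF assms(1,4)] by (auto simp: less_Suc_eq_le)
  ultimately obtain \<sigma> where \<sigma>: "\<sigma> \<in> chain T \<tau>" and max: "\<And>\<sigma>'. \<sigma>' \<in> chain T \<tau> \<Longrightarrow> length \<sigma>' \<le> length \<sigma>"
    using ex_has_greatest_nat[of "\<lambda>\<sigma>. \<sigma> \<in> chain T \<tau>" \<tau> length "Suc n"] by blast
  have "\<not> progress \<sigma> \<rho>" if "T \<rho>" for \<rho>
  proof
    assume "progress \<sigma> \<rho>"
    with that obtain \<rho>' where \<rho>': "adopted T \<sigma> \<rho>'"
      unfolding adopted_def
      using ex_has_least_nat[of "\<lambda>\<rho>. T \<rho> \<and> progress \<sigma> \<rho>" \<rho> enc] by (metis not_le)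
    then have "(\<sigma> @ lift3 \<rho>') @ [0] \<in> chain T \<tau>"
      using \<sigma> hyper_adopted[OF assms(2) _ _ \<rho>'] block_snoc[of "\<sigma> @ lift3 \<rho>'" 0]
      by (auto simp: chain_def)
    from max[OF this] show False by simp
  qed
  with \<sigma> show thesis by (rule that)
qed

text \<open>Only finitely much of the oracle is used to compute the first
  \<open>length \<beta>\<close> values of \<open>f\<close>. Hence, above a stuck string, the target
  fails on the whole copy of \<open>paths T\<close>.\<close>

lemma ex_progress:
  assumes "f \<in> Q" and "\<And>x. run (prepend \<beta> (\<lambda>n. 3 + p n)) (target \<beta>) x = Some (f x)"
  shows "\<exists>n. progress \<beta> (initseg p n)"
proof -
  let ?g = "prepend \<beta> (\<lambda>n. 3 + p n)"
  let ?F = "(\<lambda>i. (target \<beta>, i, f i)) ` {..<length \<beta>}"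
  have "\<exists>n w. cert (initseg ?g n) w \<and> ?F \<subseteq> set w"
    by (rule cert_complete_finite) (auto simp: assms(2))
  then obtain n w where w: "cert (initseg ?g n) w" "?F \<subseteq> set w"
    by blast
  let ?z = "(initseg f (length \<beta>), w)"
  \<comment> \<open>Long enough both for the oracle values used in \<open>w\<close> and for the
    bound that \<open>progress\<close> puts on the code of the evidence.\<close>
  let ?m = "n + Suc (enc ?z)"
  have seg: "\<beta> @ lift3 (initseg p ?m) = initseg ?g (length \<beta> + ?m)"
    by (simp only: initseg_prepend initseg_add)
  have "cert (\<beta> @ lift3 (initseg p ?m)) w"
    unfolding seg using w(1) by (rule cert_mono) (simp add: prefix_initseg)
  moreover have "TQ (initseg f (length \<beta>))"
    using assms(1) by (simp add: Q_eq pathsD)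
  moreover have "enc ?z < length (initseg p ?m)" by simp
  ultimately have "progress \<beta> (initseg p ?m)"
    unfolding progress_def using w(2) by (intro exI[of _ ?z]) auto
  then show ?thesis ..
qed

subsection \<open>One more learner\<close>

definition coding :: "(nat list \<Rightarrow> bool) \<Rightarrow> (nat \<Rightarrow> nat) \<Rightarrow> nat list \<Rightarrow> bool" where
  "coding T q \<sigma> \<longleftrightarrow> hyper T \<sigma> \<and> coded \<sigma> = initseg q (length (coded \<sigma>))"

text \<open>A block may be abandoned at any time by paying the next bit of \<open>q\<close>, which
  is coded as the symbol 1 or 2.\<close>

lemma coding_extend:
  assumes "q \<in> P" and "coding T q \<sigma>"
  shows "\<exists>\<tau>. coding T q \<tau> \<and> prefix \<sigma> \<tau> \<and> block \<tau> = [] \<and> length (coded \<tau>) = length (coded \<sigma>) + Suc k"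
proof -
  have one: "\<exists>\<tau>. coding T q \<tau> \<and> prefix \<sigma> \<tau> \<and> block \<tau> = [] \<and> length (coded \<tau>) = Suc (length (coded \<sigma>))"
    if "coding T q \<sigma>" for \<sigma>
  proof -
    let ?n = "length (coded \<sigma>)"
    have TP: "TP (initseg q (Suc ?n))"
      using assms(1) by (simp add: P_eq pathsD)
    then have "q ?n \<le> 1"
      by (rule binary_TP) (simp add: initseg_Suc)
    moreover have "TP (coded \<sigma> @ [q ?n])"
      using TP that by (simp add: initseg_Suc coding_def)
    ultimately have "coding T q (\<sigma> @ [Suc (q ?n)])"
      using that by (auto simp: coding_def allowed_def initseg_Suc)
    with \<open>q ?n \<le> 1\<close> show ?thesis
      by (intro exI[of _ "\<sigma> @ [Suc (q ?n)]"]) auto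
  qed
  show ?thesis
  proof (induction k)
    case 0
    show ?case using one[OF assms(2)] by simp
  next
    case (Suc k)
    then show ?case using one by (metis add_Suc_right prefix_order.trans)
  qed
qed

lemma coding_stuck:
  assumes T: "udec UNIV (\<lambda>_. T)" "tree T" and "q \<in> P" and "coding T q \<sigma>"
  obtains \<tau> where "coding T q \<tau>" and "prefix \<sigma> \<tau>" and "block \<tau> = []" and "target \<tau> = c"
    and "\<And>\<rho>. T \<rho> \<Longrightarrow> \<not> progress \<tau> \<rho>"
proof -
  \<comment> \<open>Paying up to exactly this count makes \<open>c\<close> the target. The second
    component lifts the count above the present one.\<close>
  let ?N = "prod_encode (enc c, Suc (length (coded \<sigma>)))"
  have "length (coded \<sigma>) < ?N"
    using le_prod_encode_2[of "Suc (length (coded \<sigma>))" "enc c"] by simp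
  then obtain k where k: "?N = length (coded \<sigma>) + Suc k"
    using less_iff_Suc_add by auto
  obtain \<beta> where \<beta>: "coding T q \<beta>" "prefix \<sigma> \<beta>" "block \<beta> = []" "length (coded \<beta>) = ?N"
    using coding_extend[OF assms(3,4), of k] unfolding k by blast
  obtain \<tau> where \<tau>: "\<tau> \<in> chain T \<beta>" "\<And>\<rho>. T \<rho> \<Longrightarrow> \<not> progress \<tau> \<rho>"
    using ex_stuck[OF T _ \<beta>(3)] \<beta>(1) unfolding coding_def by blast
  have "coded \<beta> = coded \<tau>"
    using \<tau>(1) prefix_coded[of \<beta> \<tau>] by (auto simp: chain_def prefix_def)
  show thesis
  proof (rule that)
    show "coding T q \<tau>"
      using \<beta>(1) \<tau>(1) \<open>coded \<beta> = coded \<tau>\<close> by (simp add: coding_def chain_def)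
    show "prefix \<sigma> \<tau>"
      using \<beta>(2) \<tau>(1) by (auto simp: chain_def intro: prefix_order.trans)
    show "block \<tau> = []"
      using \<tau>(1) by (simp add: chain_def)
    show "target \<tau> = c"
      using \<beta>(4) \<open>coded \<beta> = coded \<tau>\<close> by (simp add: target_def del: enc_code_def)
  qed (rule \<tau>(2))
qed

lemma paths_hyperI:
  assumes "tree T" and "hyper T \<tau>" and "block \<tau> = []" and "p \<in> paths T"
  shows "prepend \<tau> (\<lambda>n. 3 + p n) \<in> paths (hyper T)"
  by (rule prepend_in_pathsI[OF tree_hyper])
    (use assms in \<open>simp add: initseg_add hyper_lift3 pathsD\<close>)

lemma ucomp_prepend [ucomp_intros]:
  "ucomp G (\<lambda>g n. F g n) \<Longrightarrow> ucomp G (\<lambda>g. prepend \<sigma> (F g))"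
  unfolding prepend_def by (intro ucomp_intros) (rule ucomp_compose, assumption, intro ucomp_intros)

theorem defeats_hyper:
  assumes T: "udec UNIV (\<lambda>_. T)" "tree T" and IH: "defeats Q n (paths T)"
  shows "defeats Q (Suc n) (paths (hyper T))"
  unfolding defeats_def
proof (intro allI impI, elim conjE)
  fix L :: "(nat list \<Rightarrow> code) set"
  assume L: "finite L" "card L \<le> Suc n"
  obtain q where q: "q \<in> P" using P_nonempty by blast
  show "\<exists>g\<in>paths (hyper T). \<forall>\<Psi>\<in>L. \<not> succeeds Q \<Psi> g"
  proof (cases "\<exists>\<Psi>\<in>L. \<exists>\<sigma>. coding T q \<sigma> \<and> (\<forall>\<tau>. coding T q \<tau> \<longrightarrow> prefix \<sigma> \<tau> \<longrightarrow> \<Psi> \<tau> = \<Psi> \<sigma>)")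
    case True
    then obtain \<Psi> \<sigma> where \<Psi>: "\<Psi> \<in> L" and \<sigma>: "coding T q \<sigma>"
      and stable: "\<And>\<tau>. coding T q \<tau> \<Longrightarrow> prefix \<sigma> \<tau> \<Longrightarrow> \<Psi> \<tau> = \<Psi> \<sigma>"
      by blast
    \<comment> \<open>The program that \<open>\<Psi>\<close> now guesses forever becomes the target
      at a stuck string \<open>\<tau>\<close>, so it fails on the copy of \<open>paths T\<close>
      above \<open>\<tau>\<close>. At most \<open>n\<close> other learners remain.\<close>
    obtain \<tau> where \<tau>: "coding T q \<tau>" "prefix \<sigma> \<tau>" "block \<tau> = []" "target \<tau> = \<Psi> \<sigma>"
      and stuck: "\<And>\<rho>. T \<rho> \<Longrightarrow> \<not> progress \<tau> \<rho>"
      using coding_stuck[OF T q \<sigma>] by blast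
    define G where "G p = prepend \<tau> (\<lambda>n. 3 + p n)" for p :: "nat \<Rightarrow> nat"
    have "ucomp UNIV G"
      unfolding G_def by (intro ucomp_intros)
    then obtain c where c: "\<And>p n. run p c n = Some (G p n)"
      unfolding ucomp_def by auto
    have seg: "\<tau> @ lift3 (initseg p n) = initseg (G p) (length \<tau> + n)" for p n
      by (simp add: G_def initseg_prepend initseg_add)
    let ?t = "\<lambda>\<Psi> \<rho>. oracle_subst c (\<Psi> (\<tau> @ lift3 \<rho>))"
    have "card (L - {\<Psi>}) \<le> n"
      using L \<Psi> by simp
    then have "finite (?t ` (L - {\<Psi>})) \<and> card (?t ` (L - {\<Psi>})) \<le> n"
      using L card_image_le[of "L - {\<Psi>}" ?t] by auto
    then obtain p where p: "p \<in> paths T" "\<forall>\<Psi>'\<in>?t ` (L - {\<Psi>}). \<not> succeeds Q \<Psi>' p"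
      using IH unfolding defeats_def by blast
    have "\<not> succeeds Q \<Psi>' (G p)" if "\<Psi>' \<in> L - {\<Psi>}" for \<Psi>'
    proof
      assume "succeeds Q \<Psi>' (G p)"
      then have "succeeds Q (?t \<Psi>') p"
        by (intro succeeds_transfer[where g = "G p" and k = "\<lambda>n. length \<tau> + n"])
          (auto simp: c seg filterlim_plus_nat)
      with p(2) that show False by blast
    qed
    moreover have "\<not> succeeds Q \<Psi> (G p)"
    proof
      assume "succeeds Q \<Psi> (G p)"
      then obtain d f where d: "\<forall>\<^sub>F n in sequentially. \<Psi> (initseg (G p) n) = d"
        and f: "f \<in> Q" "\<forall>x. run (G p) d x = Some (f x)"
        unfolding succeeds_def by blast
      obtain N where N: "\<And>n. N \<le> n \<Longrightarrow> \<Psi> (initseg (G p) n) = d"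
        using d unfolding eventually_sequentially by blast
      \<comment> \<open>Strings of the copy code no bits beyond those of \<open>\<tau>\<close>, so
        stability applies to them.\<close>
      have "coding T q (\<tau> @ lift3 (initseg p N))"
        using \<tau>(1,3) p(1) T(2) by (simp add: coding_def hyper_lift3 pathsD)
      then have "\<Psi> (\<tau> @ lift3 (initseg p N)) = \<Psi> \<sigma>"
        by (rule stable) (rule prefix_prefix[OF \<tau>(2)])
      with N[of "length \<tau> + N"] have "d = target \<tau>"
        by (simp add: seg \<tau>(4))
      with f ex_progress[of f \<tau> p] obtain m where "progress \<tau> (initseg p m)"
        unfolding G_def by blast
      with stuck p(1) show False
        by (simp add: pathsD)
    qed
    moreover have "G p \<in> paths (hyper T)"
      unfolding G_def using T(2) _ \<tau>(3) p(1) by (rule paths_hyperI) (use \<tau>(1) in \<open>simp add: coding_def\<close>)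
    ultimately show ?thesis by blast
  next
    case False
    then have change: "\<exists>\<tau>. coding T q \<tau> \<and> prefix \<sigma> \<tau> \<and> \<Psi> \<tau> \<noteq> \<Psi> \<sigma>" if "\<Psi> \<in> L" "coding T q \<sigma>" for \<Psi> \<sigma>
      using that by blast
    have all_change: "\<exists>\<tau>. coding T q \<tau> \<and> prefix \<sigma> \<tau> \<and> length \<sigma> < length \<tau> \<and>
        (\<forall>\<Psi>\<in>L'. \<exists>\<pi>. prefix \<sigma> \<pi> \<and> prefix \<pi> \<tau> \<and> \<Psi> \<pi> \<noteq> \<Psi> \<sigma>)"
      if \<sigma>: "coding T q \<sigma>" and "finite L'" "L' \<subseteq> L" for \<sigma> L'
      using that(2,3)
    proof (induction L')
      case empty
      obtain \<tau> where "coding T q \<tau>" "prefix \<sigma> \<tau>" "length (coded \<tau>) = length (coded \<sigma>) + Suc 0"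
        using coding_extend[OF q \<sigma>, of 0] by blast
      moreover from this have "\<sigma> \<noteq> \<tau>" by auto
      ultimately show ?case
        using prefix_length_less[of \<sigma> \<tau>] by (auto simp: strict_prefix_def)
    next
      case (insert \<Psi> L')
      then obtain \<tau> where \<tau>: "coding T q \<tau>" "prefix \<sigma> \<tau>" "length \<sigma> < length \<tau>"
        "\<forall>\<Psi>\<in>L'. \<exists>\<pi>. prefix \<sigma> \<pi> \<and> prefix \<pi> \<tau> \<and> \<Psi> \<pi> \<noteq> \<Psi> \<sigma>"
        by auto
      have "\<Psi> \<in> L" using insert.prems by simp
      \<comment> \<open>The guess at \<open>\<tau>'\<close> differs from that at
        \<open>\<tau>\<close>, so at least one of the two differs from the guess at
        \<open>\<sigma>\<close>.\<close>
      then obtain \<tau>' where \<tau>': "coding T q \<tau>'" "prefix \<tau> \<tau>'" "\<Psi> \<tau> \<noteq> \<Psi> \<sigma> \<or> \<Psi> \<tau>' \<noteq> \<Psi> \<sigma>"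
        using change[OF _ \<tau>(1)] by metis
      show ?case
      proof (rule exI[of _ \<tau>'], intro conjI ballI)
        show "prefix \<sigma> \<tau>'" using \<tau>(2) \<tau>'(2) by (rule prefix_order.trans)
        show "length \<sigma> < length \<tau>'" using \<tau>(3) prefix_length_le[OF \<tau>'(2)] by simp
        fix \<Psi>'
        assume "\<Psi>' \<in> insert \<Psi> L'"
        then show "\<exists>\<pi>. prefix \<sigma> \<pi> \<and> prefix \<pi> \<tau>' \<and> \<Psi>' \<pi> \<noteq> \<Psi>' \<sigma>"
          using \<tau> \<tau>' by (metis insert_iff prefix_order.order_refl prefix_order.trans)
      qed (rule \<tau>'(1))
    qed
    have "coding T q []" by (simp add: coding_def)
    then obtain s where s: "\<And>n. coding T q (s n)"
      and step: "\<And>n. prefix (s n) (s (Suc n)) \<and> length (s n) < length (s (Suc n)) \<and>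
        (\<forall>\<Psi>\<in>L. \<exists>\<pi>. prefix (s n) \<pi> \<and> prefix \<pi> (s (Suc n)) \<and> \<Psi> \<pi> \<noteq> \<Psi> (s n))"
      using dependent_nat_choice[of "\<lambda>_. coding T q" "\<lambda>_ \<sigma> \<tau>. prefix \<sigma> \<tau> \<and> length \<sigma> < length \<tau> \<and>
        (\<forall>\<Psi>\<in>L. \<exists>\<pi>. prefix \<sigma> \<pi> \<and> prefix \<pi> \<tau> \<and> \<Psi> \<pi> \<noteq> \<Psi> \<sigma>)"]
        all_change[OF _ L(1) subset_refl] by blast
    have len: "n \<le> length (s n)" for n
    proof (induction n)
      case (Suc n)
      with step[of n] show ?case by simp
    qed simp
    obtain g where g: "\<And>n. s n = initseg g (length (s n))"
      using ex_limit[of s] step len by blast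
    have "g \<in> paths (hyper T)"
      by (rule pathsI_cofinal[OF tree_hyper]) (metis coding_def g len s)
    moreover have "\<not> succeeds Q \<Psi> g" if "\<Psi> \<in> L" for \<Psi>
    proof
      assume "succeeds Q \<Psi> g"
      then obtain c N where N: "\<And>n. N \<le> n \<Longrightarrow> \<Psi> (initseg g n) = c"
        unfolding succeeds_def eventually_sequentially by blast
      obtain \<pi> where \<pi>: "prefix (s N) \<pi>" "prefix \<pi> (s (Suc N))" "\<Psi> \<pi> \<noteq> \<Psi> (s N)"
        using step[of N] \<open>\<Psi> \<in> L\<close> by blast
      have "\<pi> = initseg g (length \<pi>)"
        using \<pi>(2) g by (metis prefix_initsegD)
      moreover have "N \<le> length \<pi>"
        using len[of N] prefix_length_le[OF \<pi>(1)] by simp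
      ultimately show False
        using \<pi>(3) N[of "length \<pi>"] N[OF len[of N]] g[of N] by metis
    qed
    ultimately show ?thesis by blast
  qed
qed

text \<open>If infinitely many bits are coded, they form an element of \<open>P\<close>. Otherwise
  the path either stays in one block forever, which yields a path of \<open>T\<close>, or takes
  infinitely many free steps in a row, which \<open>chain_bounded\<close> excludes.\<close>

theorem hyper_computes_P:
  assumes T: "udec UNIV (\<lambda>_. T)" "tree T" and IH: "\<And>p. p \<in> paths T \<Longrightarrow> \<exists>f\<in>P. f \<le>\<^sub>T p"
    and g: "g \<in> paths (hyper T)"
  shows "\<exists>f\<in>P. f \<le>\<^sub>T g"
proof (cases "\<forall>n. \<exists>m. n < length (coded (initseg g m))")
  case True
  define q where "q n = coded (initseg g (LEAST m. n < length (coded (initseg g m)))) !! n" for n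
  \<comment> \<open>The search for a stage with more than \<open>n\<close> bits is known to halt for
    \<open>g\<close>, hence the class \<open>{g}\<close>.\<close>
  have "ucomp {g} (\<lambda>h n. coded (initseg h (LEAST m. n < length (coded (initseg h m)))) !! n)"
    by (intro ucomp_intros ucomp_Least) (use True in auto)
  then have "ucomp {g} (\<lambda>_. q)"
    by (rule ucomp_cong) (simp add: q_def)
  then have "q \<le>\<^sub>T g"
    by (simp add: turing_le_iff_ucomp)
  moreover have coded_q: "coded (initseg g m) = initseg q (length (coded (initseg g m)))" for m
  proof (rule nth_equalityI)
    fix i assume i: "i < length (coded (initseg g m))"
    let ?m = "LEAST m. i < length (coded (initseg g m))"
    have "i < length (coded (initseg g ?m))"
      using i by (rule LeastI)
    moreover have "prefix (coded (initseg g ?m)) (coded (initseg g m))"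
      using Least_le[of "\<lambda>m. i < length (coded (initseg g m))" m] i by (intro prefix_coded prefix_initseg)
    ultimately show "coded (initseg g m) ! i = initseg q (length (coded (initseg g m))) ! i"
      using i by (auto simp: q_def prefix_def nth_append)
  qed simp
  have "q \<in> P"
    unfolding P_eq
  proof (rule pathsI_cofinal[OF tree_TP])
    fix n
    obtain m where "n < length (coded (initseg g m))" using True by blast
    with TP_coded[OF pathsD[OF g, of m]] coded_q[of m] show "\<exists>k\<ge>n. TP (initseg q k)"
      by (metis less_imp_le)
  qed
  ultimately show ?thesis by blast
next
  case False
  then obtain N where "\<forall>m. length (coded (initseg g m)) < Suc N"
    by (auto simp: not_less less_Suc_eq_le)
  \<comment> \<open>From stage \<open>m0\<close> on no further bit is coded.\<close>
  then obtain m0 where m0: "\<And>m. length (coded (initseg g m)) \<le> length (coded (initseg g m0))"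
    using ex_has_greatest_nat[of "\<lambda>_. True" 0 "\<lambda>m. length (coded (initseg g m))" "Suc N"] by auto
  have coded_eq: "length (coded (initseg g m)) = length (coded (initseg g m0))" if "m0 \<le> m" for m
    using m0[of m] prefix_length_le[OF prefix_coded[OF prefix_initseg[OF that, of g]]] by simp
  show ?thesis
  proof (cases "\<exists>l. \<forall>m\<ge>l. 3 \<le> g m")
    case True
    \<comment> \<open>Leastness matters: the symbol just before \<open>l\<close>, if any, is below
      3, so the final block begins exactly at \<open>l\<close>.\<close>
    define l where "l = (LEAST l. \<forall>m\<ge>l. 3 \<le> g m)"
    have l: "3 \<le> g m" if "l \<le> m" for m
      using LeastI_ex[OF True] that unfolding l_def by blast
    have block_l: "block (initseg g l) = []"
    proof (cases l)
      case (Suc k)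
      then have "\<not> (\<forall>m\<ge>k. 3 \<le> g m)"
        using not_less_Least[of k "\<lambda>l. \<forall>m\<ge>l. 3 \<le> g m"] unfolding l_def by simp
      then have "g k < 3"
        using l Suc by (metis le_antisym not_le not_less_eq_eq)
      then show ?thesis by (simp add: Suc initseg_Suc)
    qed simp
    define p where "p n = g (l + n) - 3" for n
    have block_p: "block (initseg g (l + n)) = initseg p n" for n
      using l by (induction n) (simp_all add: block_l initseg_Suc p_def)
    have "T (initseg p (Suc n))" for n
      using pathsD[OF g, of "Suc (l + n)"] l[of "l + n"] block_p[of n]
      by (simp add: initseg_Suc allowed_def p_def)
    then have "p \<in> paths T"
      by (intro pathsI_cofinal[OF T(2)]) (meson le_Suc_eq order_refl)
    then obtain f where "f \<in> P" "f \<le>\<^sub>T p" using IH by blast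
    moreover have "p \<le>\<^sub>T g"
    proof -
      have "ucomp {g} (\<lambda>h n. h (l + n) - 3)"
        by (intro ucomp_intros)
      then have "ucomp {g} (\<lambda>_. p)"
        by (rule ucomp_cong) (simp add: p_def)
      then show ?thesis by (simp add: turing_le_iff_ucomp)
    qed
    ultimately show ?thesis using turing_le_trans by blast
  next
    case False
    then have inf: "\<exists>m\<ge>l. g m < 3" for l by (metis not_le)
    obtain m1 where m1: "m0 \<le> m1" "g m1 < 3" using inf by blast
    let ?\<tau> = "initseg g (Suc m1)"
    have block_\<tau>: "block ?\<tau> = []" using m1 by (simp add: initseg_Suc)
    obtain n where n: "\<And>\<sigma>. \<sigma> \<in> chain T ?\<tau> \<Longrightarrow> length \<sigma> \<le> n"
      using chain_bounded[OF T(1) block_\<tau>] by blast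
    obtain m where m: "max m1 n \<le> m" "g m < 3" using inf by blast
    \<comment> \<open>A late abandoning symbol that codes no bit ends a member of the chain longer
      than the bound \<open>n\<close>.\<close>
    have "initseg g (Suc m) \<in> chain T ?\<tau>"
      using m m1 pathsD[OF g, of "Suc m"] coded_eq[of "Suc m"] coded_eq[of "Suc m1"] prefix_initseg[of "Suc m1" "Suc m" g]
      by (auto simp: chain_def initseg_Suc[of g m] simp del: coded_append)
    from n[OF this] m show ?thesis by simp
  qed
qed

end

context pi01_pair
begin

section \<open>Iterated hyperconcatenation\<close>

primrec level :: "nat \<Rightarrow> nat list \<Rightarrow> bool" where
  "level 0 = TP"
| "level (Suc b) = hyper (level b)"

lemma tree_level: "tree (level b)"
  by (cases b) (simp_all add: tree_TP tree_hyper)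

text \<open>
  A program for \<open>level (Suc b)\<close> arises from one for \<open>level b\<close> by oracle substitution, so that
  programs for all levels are found uniformly.
\<close>

lemma udec_level_uniform: "udec UNIV (\<lambda>_ z. level (fst z) (snd z))"
proof -
  obtain c where c: "\<And>g \<sigma>. run g c (enc \<sigma>) = Some (of_bool (TP \<sigma>))"
    using udec_TP unfolding udec_def ucomp_def by auto
  \<comment> \<open>The oracle plays the part of the tree of one level; the program \<open>d\<close>
    then decides the next level.\<close>
  have "udec UNIV (\<lambda>g \<sigma>. hyper (\<lambda>\<rho>. g (enc \<rho>) \<noteq> 0) \<sigma>)"
    by (intro udec_hyper ucomp_intros)
  then obtain d where d: "\<And>g \<sigma>. run g d (enc \<sigma>) = Some (of_bool (hyper (\<lambda>\<rho>. g (enc \<rho>) \<noteq> 0) \<sigma>))"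
    unfolding udec_def ucomp_def by auto
  define C where "C = rec_nat c (\<lambda>_ e. oracle_subst e d)"
  have C: "run g (C b) (enc \<sigma>) = Some (of_bool (level b \<sigma>))" for g b \<sigma>
  proof (induction b arbitrary: g \<sigma>)
    case 0
    show ?case by (simp add: C_def c)
  next
    case (Suc b)
    have "run g (C b) n = Some (of_bool (level b (dec n)))" for n
      using Suc.IH[of g "dec n"] by simp
    then have "run g (oracle_subst (C b) d) = run (\<lambda>n. of_bool (level b (dec n))) d"
      by (rule run_oracle_subst)
    then have "run g (C (Suc b)) = run (\<lambda>n. of_bool (level b (dec n))) d"
      by (simp add: C_def)
    then show ?case by (simp add: d)
  qed
  have "ucomp UNIV (\<lambda>_. C)"
    unfolding C_def by (intro ucomp_intros)
  then have "ucomp UNIV (\<lambda>_ z. of_bool (level (fst z) (snd z)) :: nat)"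
    by (rule ucomp_universal) (simp add: C)
  then show ?thesis by (simp add: udec_def)
qed

lemma udec_level': "ucomp G A \<Longrightarrow> ucomp G B \<Longrightarrow> udec G (\<lambda>g x. level (A g x) (B g x))"
  using udec_compose[OF udec_mono[OF udec_level_uniform] ucomp_Pair] by fastforce

lemma udec_level: "udec UNIV (\<lambda>_. level b)"
  by (intro udec_level' ucomp_intros)

lemma defeats_level: "defeats Q b (paths (level b))"
proof (induction b)
  case 0
  then show ?case using P_nonempty by (auto simp: defeats_def P_eq)
next
  case (Suc b)
  then show ?case by (simp add: defeats_hyper udec_level tree_level)
qed

lemma level_bounded: "level b \<sigma> \<Longrightarrow> a \<in> set \<sigma> \<Longrightarrow> a \<le> 3 * b + 1"
proof (induction b arbitrary: \<sigma> a)
  case 0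
  then show ?case using binary_TP by simp
next
  case (Suc b)
  then show ?case using hyper_bounded[of "level b" "3 * b + 1" \<sigma> a] by simp
qed

lemma level_computes_P: "g \<in> paths (level b) \<Longrightarrow> \<exists>f\<in>P. f \<le>\<^sub>T g"
proof (induction b arbitrary: g)
  case 0
  moreover have "g \<le>\<^sub>T g"
    unfolding turing_le_def by (rule exI[of _ COracle]) simp
  ultimately show ?case by (auto simp: P_eq)
next
  case (Suc b)
  show ?case
    using Suc.prems by (intro hyper_computes_P[OF udec_level tree_level Suc.IH]) simp_all
qed

text \<open>The number of symbols before the first \<open>0\<close> selects the level of what follows it.\<close>

definition level_sum :: "nat list \<Rightarrow> bool" where
  "level_sum \<sigma> \<longleftrightarrow>
     (\<forall>m<Suc (length \<sigma>). (\<forall>i<m. \<sigma> !! i \<noteq> 0) \<longrightarrow> TP (map (\<lambda>a. a - 1) (take m \<sigma>))) \<and>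
     (\<forall>m<length \<sigma>. (\<forall>i<m. \<sigma> !! i \<noteq> 0) \<and> \<sigma> !! m = 0 \<longrightarrow> level m (drop (Suc m) \<sigma>))"

lemma udec_level_sum: "ucomp G A \<Longrightarrow> udec G (\<lambda>g x. level_sum (A g x))"
  by (rule udec_compose[of G "\<lambda>g. level_sum"]) (unfold level_sum_def, intro ucomp_intros udec_level')

lemma level_sum_initseg:
  "level_sum (initseg g n) \<longleftrightarrow>
     (\<forall>m\<le>n. (\<forall>i<m. g i \<noteq> 0) \<longrightarrow> TP (initseg (\<lambda>i. g i - 1) m)) \<and>
     (\<forall>m<n. (\<forall>i<m. g i \<noteq> 0) \<and> g m = 0 \<longrightarrow> level m (initseg (\<lambda>i. g (Suc m + i)) (n - Suc m)))"
  unfolding level_sum_def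
  by (auto simp: drop_initseg map_initseg less_Suc_eq_le min_absorb1 del: initseg_Suc)

lemma Suc_in_level_sum: "p \<in> P \<Longrightarrow> (\<lambda>n. Suc (p n)) \<in> paths level_sum"
  by (intro pathsI) (simp add: level_sum_initseg P_eq pathsD)

text \<open>The first \<open>n\<close> bits of \<open>q\<close>, shifted away from 0, followed by a
  0 select level \<open>n\<close>. Any element of \<open>P\<close> can serve as
  \<open>q\<close>.\<close>

lemma level_in_level_sum:
  assumes "q \<in> P" and "g \<in> paths (level n)"
  shows "prepend (map Suc (initseg q n) @ [0]) g \<in> paths level_sum" (is "?g \<in> _")
proof (rule pathsI)
  have lt: "?g i = Suc (q i)" if "i < n" for i
    using that by (simp add: prepend_def nth_append)
  have eq: "?g n = 0"
    by (simp add: prepend_def nth_append)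
  have gt: "?g (Suc n + i) = g i" for i
    by (simp add: prepend_def)
  have le: "m \<le> n" if "\<forall>i<m. ?g i \<noteq> 0" for m
    using that eq by (meson not_le)
  have "initseg (\<lambda>i. ?g i - 1) m = initseg q m" if "m \<le> n" for m
    using that by (intro nth_equalityI) (simp_all add: lt)
  moreover have "m = n" if "\<forall>i<m. ?g i \<noteq> 0" "?g m = 0" for m
    using le[OF that(1)] that(2) lt[of m] by fastforce
  moreover have "(\<lambda>i. ?g (Suc n + i)) = g"
    by (simp only: gt)
  ultimately show "level_sum (initseg ?g k)" for k
    unfolding level_sum_initseg using assms le by (metis P_eq pathsD)
qed

lemma level_sum_cases:
  assumes "g \<in> paths level_sum"
  obtains (path) "\<And>n. g n \<noteq> 0" and "(\<lambda>n. g n - 1) \<in> P"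
  | (level) m where "\<And>i. i < m \<Longrightarrow> g i \<noteq> 0" and "g m = 0" and "(\<lambda>i. g (Suc m + i)) \<in> paths (level m)"
proof (cases "\<exists>m. g m = 0")
  case True
  define m where "m = (LEAST m. g m = 0)"
  have m: "g m = 0" "\<And>i. i < m \<Longrightarrow> g i \<noteq> 0"
    using LeastI_ex[OF True] not_less_Least unfolding m_def by auto
  have "level m (initseg (\<lambda>i. g (Suc m + i)) n)" for n
  proof -
    have "m < Suc m + n" by simp
    then have "level m (initseg (\<lambda>i. g (Suc m + i)) (Suc m + n - Suc m))"
      using pathsD[OF assms, of "Suc m + n"] m unfolding level_sum_initseg by blast
    then show ?thesis by simp
  qed
  then show thesis
    using m by (intro level pathsI)
next
  case False
  moreover have "TP (initseg (\<lambda>n. g n - 1) n)" for n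
    using pathsD[OF assms, of n] False unfolding level_sum_initseg by auto
  ultimately show thesis
    by (intro path) (auto simp: P_eq intro: pathsI)
qed

text \<open>Symbols before the first 0 are at most 2. If that 0 is at position \<open>m\<close>,
  later symbols are at most \<open>3 * m + 1\<close> by \<open>level_bounded\<close> and stand at
  positions beyond \<open>m\<close>. A bound of this kind is what the coding by graphs
  needs.\<close>

lemma level_sum_bounded:
  assumes "g \<in> paths level_sum"
  shows "g n \<le> 3 * n + 2"
  using assms
proof (cases rule: level_sum_cases)
  case path
  then have "TP (initseg (\<lambda>n. g n - 1) (Suc n))"
    by (simp add: P_eq pathsD)
  then have "g n - 1 \<le> 1"
    by (rule binary_TP) (simp add: initseg_Suc)
  then show ?thesis by simp
next
  case (level m)
  have TP: "TP (initseg (\<lambda>i. g i - 1) m)"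
    using pathsD[OF assms, of m] level unfolding level_sum_initseg by auto
  consider "n < m" | "n = m" | i where "n = Suc m + i"
    by (metis less_imp_Suc_add nat_neq_iff add_Suc)
  then show ?thesis
  proof cases
    case 1
    then have "g n - 1 \<in> set (initseg (\<lambda>i. g i - 1) m)"
      by (auto simp: initseg_def)
    with TP have "g n - 1 \<le> 1" by (rule binary_TP)
    then show ?thesis by simp
  next
    case 2
    then show ?thesis using level by simp
  next
    case (3 i)
    have "level m (initseg (\<lambda>i. g (Suc m + i)) (Suc i))"
      using level by (simp only: pathsD)
    then have "g (Suc m + i) \<le> 3 * m + 1"
      by (rule level_bounded) (simp add: initseg_Suc)
    then show ?thesis using 3 by simp
  qed
qed

lemma level_sum_computes_P:
  assumes "g \<in> paths level_sum"
  shows "\<exists>f\<in>P. f \<le>\<^sub>T g"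
  using assms
proof (cases rule: level_sum_cases)
  case path
  have "ucomp {g} (\<lambda>h n. h n - 1)"
    by (intro ucomp_intros)
  then have "ucomp {g} (\<lambda>_ n. g n - 1)"
    by (rule ucomp_cong) simp
  with path(2) show ?thesis
    by (auto simp: turing_le_iff_ucomp)
next
  case (level m)
  have "ucomp {g} (\<lambda>h i. h (Suc m + i))"
    by (intro ucomp_intros)
  then have "ucomp {g} (\<lambda>_ i. g (Suc m + i))"
    by (rule ucomp_cong) simp
  then have "(\<lambda>i. g (Suc m + i)) \<le>\<^sub>T g"
    by (simp add: turing_le_iff_ucomp)
  with level_computes_P[OF level(3)] show ?thesis
    using turing_le_trans by blast
qed

lemma defeats_level_sum: "defeats Q b (paths level_sum)"
proof -
  obtain q where q: "q \<in> P" using P_nonempty by blast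
  let ?\<tau> = "map Suc (initseg q b) @ [0]"
  have G: "ucomp UNIV (prepend ?\<tau>)"
    by (rule ucomp_prepend[OF ucomp_oracle[OF ucomp_id]])
  show ?thesis
    by (rule defeats_transfer[OF defeats_level G initseg_prepend[symmetric] filterlim_plus_nat])
      (rule level_in_level_sum[OF q])
qed

end

section \<open>Coding by graphs\<close>

definition graph :: "(nat \<Rightarrow> nat) \<Rightarrow> nat \<Rightarrow> nat" where
  "graph g x = of_bool (g (fst (prod_decode x)) = snd (prod_decode x))"

lemma fst_prod_decode_le: "fst (prod_decode x) \<le> x"
  by (metis le_prod_encode_1 prod.collapse prod_decode_inverse)

lemma ucomp_graph: "ucomp UNIV graph"
  unfolding graph_def by (intro ucomp_intros)

lemma graph_turing_le: "graph g \<le>\<^sub>T g"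
  unfolding turing_le_iff_ucomp
  by (rule ucomp_cong[OF ucomp_mono[OF ucomp_graph]]) auto

lemma turing_le_graph: "g \<le>\<^sub>T graph g"
proof -
  have "ucomp {graph g} (\<lambda>h n. LEAST s. h (prod_encode (n, s)) = 1)"
    by (intro ucomp_intros ucomp_Least) (auto simp: graph_def)
  then show ?thesis
    unfolding turing_le_iff_ucomp by (rule ucomp_cong) (auto simp: graph_def intro!: Least_equality)
qed

text \<open>As \<open>fst (prod_decode i) \<le> i\<close>, the first \<open>n\<close> values of
  \<open>p\<close> determine the first \<open>n\<close> values of its graph.\<close>

lemma defeats_graph:
  assumes "defeats Q n S"
  shows "defeats Q n (graph ` S)"
proof (rule defeats_transfer[OF assms ucomp_graph])
  show "initseg (graph (\<lambda>i. initseg p n !! i)) (length (initseg p n)) = initseg (graph p) (id n)" for p n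
  proof (rule nth_equalityI)
    fix i assume "i < length (initseg (graph (\<lambda>i. initseg p n !! i)) (length (initseg p n)))"
    then have "i < n" by simp
    with fst_prod_decode_le[of i] show "initseg (graph (\<lambda>i. initseg p n !! i)) (length (initseg p n)) ! i =
        initseg (graph p) (id n) ! i"
      by (simp add: graph_def)
  qed simp
qed (simp_all add: filterlim_ident id_def)

text \<open>The arguments \<open>s\<close> from 0 to \<open>3 * n + 2\<close> are tried and the last
  hit wins, with default 0. Being bounded, the search is total for every \<open>h\<close> and reads
  a known finite part of it.\<close>

definition graph_value :: "(nat \<Rightarrow> nat) \<Rightarrow> nat \<Rightarrow> nat" where
  "graph_value h n = rec_nat 0 (\<lambda>s r. if h (prod_encode (n, s)) = 1 then s else r) (3 * n + 3)"

lemma graph_value_graph: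
  assumes "g n \<le> 3 * n + 2"
  shows "graph_value (graph g) n = g n"
proof -
  have "g n < k \<Longrightarrow> rec_nat 0 (\<lambda>s r. if graph g (prod_encode (n, s)) = 1 then s else r) k = g n" for k
    by (induction k) (auto simp: graph_def less_Suc_eq)
  from this[of "3 * n + 3"] assms show ?thesis
    by (simp only: graph_value_def)
qed

lemma graph_value_cong:
  assumes "\<And>s. s \<le> 3 * n + 2 \<Longrightarrow> h (prod_encode (n, s)) = h' (prod_encode (n, s))"
  shows "graph_value h n = graph_value h' n"
proof -
  have "k \<le> 3 * n + 3 \<Longrightarrow> rec_nat 0 (\<lambda>s r. if h (prod_encode (n, s)) = 1 then s else r) k =
      rec_nat 0 (\<lambda>s r. if h' (prod_encode (n, s)) = 1 then s else r) k" for k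
    by (induction k) (simp_all add: assms)
  then show ?thesis by (simp add: graph_value_def)
qed

text \<open>The pairing grows with the sum of its arguments. So a string of length
  \<open>prod_encode (m, 3 * m + 2)\<close> contains every position that \<open>graph_value\<close>
  reads at arguments below \<open>m\<close>.\<close>

lemma prod_encode_less:
  assumes "n < m" and "s \<le> 3 * n + 2"
  shows "prod_encode (n, s) < prod_encode (m, 3 * m + 2)"
proof -
  have mono: "a \<le> b \<Longrightarrow> triangle a \<le> triangle b" for a b
    by (rule lift_Suc_mono_le[of triangle]) simp_all
  have "n + s \<le> m + (3 * m + 2)"
    using assms by linarith
  from mono[OF this] assms(1) show ?thesis
    unfolding prod_encode_def prod.case by linarith
qed

text \<open>It is the bound on the values that makes a set of graphs closed.\<close>

definition graph_tree :: "(nat list \<Rightarrow> bool) \<Rightarrow> nat list \<Rightarrow> bool" where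
  "graph_tree T \<sigma> \<longleftrightarrow> (\<forall>m<Suc (length \<sigma>). prod_encode (m, 3 * m + 2) \<le> length \<sigma> \<longrightarrow>
     T (initseg (graph_value ((!!) \<sigma>)) m) \<and>
     (\<forall>x<length \<sigma>. fst (prod_decode x) < m \<longrightarrow> \<sigma> !! x = graph (graph_value ((!!) \<sigma>)) x))"

lemma udec_graph_tree:
  assumes T: "udec UNIV (\<lambda>_. T)"
  shows "udec UNIV (\<lambda>_. graph_tree T)"
  unfolding graph_tree_def graph_value_def graph_def
  by (intro ucomp_intros udec_compose[OF T])

text \<open>The bound gives \<open>graph_value (graph g) = g\<close> for paths of \<open>T\<close>.
  Conversely, long initial segments of a path \<open>h\<close> of \<open>graph_tree T\<close> force
  \<open>h\<close> to be the graph of \<open>graph_value h\<close>, and this to be a path of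
  \<open>T\<close>.\<close>

lemma graph_paths:
  assumes "\<And>g n. g \<in> paths T \<Longrightarrow> g n \<le> 3 * n + 2"
  shows "graph ` paths T = paths (graph_tree T)"
proof (intro equalityI subsetI)
  have value_eq: "graph_value ((!!) (initseg h N)) n = graph_value h n"
    if "n < m" "prod_encode (m, 3 * m + 2) \<le> N" for h N n m
    using prod_encode_less[OF that(1)] that(2)
    by (intro graph_value_cong) (metis le_less_trans length_initseg less_le_trans nth0_eq_nth nth_initseg)
  then have seg: "initseg (graph_value ((!!) (initseg h N))) m = initseg (graph_value h) m"
    if "prod_encode (m, 3 * m + 2) \<le> N" for h N m
    using that by (intro nth_equalityI) auto
  {
    fix h assume "h \<in> graph ` paths T"
    then obtain g where g: "g \<in> paths T" and h: "h = graph g" by blast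
    have "graph_value h = g"
      using assms[OF g] by (auto simp: h graph_value_graph)
    then show "h \<in> paths (graph_tree T)"
      using g value_eq seg
      by (intro pathsI) (auto simp: graph_tree_def pathsD h graph_def)
  }
  {
    fix h assume h: "h \<in> paths (graph_tree T)"
    define N where "N m = prod_encode (m, 3 * m + 2)" for m
    have N: "m \<le> N m" for m
      unfolding N_def by (rule le_prod_encode_1)
    have main: "T (initseg (graph_value ((!!) (initseg h k))) m) \<and>
        (\<forall>x<k. fst (prod_decode x) < m \<longrightarrow> initseg h k !! x = graph (graph_value ((!!) (initseg h k))) x)"
      if "N m \<le> k" for m k
    proof -
      have "m < Suc k" using that N[of m] by simp
      then show ?thesis
        using pathsD[OF h, of k] that unfolding graph_tree_def N_def length_initseg by blast
    qed
    have "T (initseg (graph_value h) m)" for m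
      using main[of m "N m"] seg[of m "N m"] by (simp add: N_def)
    moreover have "h x = graph (graph_value h) x" for x
    proof -
      let ?n = "fst (prod_decode x)"
      \<comment> \<open>Long enough to contain position \<open>x\<close> and every position that
        \<open>graph_value\<close> reads at \<open>?n\<close>.\<close>
      let ?k = "Suc x + N (Suc ?n)"
      have "initseg h ?k !! x = graph (graph_value ((!!) (initseg h ?k))) x"
        using main[of "Suc ?n" ?k] by simp
      moreover have "graph_value ((!!) (initseg h ?k)) ?n = graph_value h ?n"
        by (rule value_eq[of _ "Suc ?n"]) (simp_all add: N_def)
      ultimately show ?thesis by (simp add: graph_def)
    qed
    ultimately show "h \<in> graph ` paths T"
      by (intro image_eqI[of _ _ "graph_value h"]) (auto intro: pathsI)
  }
qed

section \<open>Reducibilities\<close>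

lemma Pi01_iff_paths: "Pi01 A \<longleftrightarrow> (\<exists>T. udec UNIV (\<lambda>_. T) \<and> A = paths T)"
  by (simp add: Pi01_def computable_on_strings_iff_udec paths_def)

text \<open>Asking \<open>R\<close> of all initial segments and bounding the entries by 1 yields a
  tree. The paths stay the same because \<open>A\<close> lies in Cantor space.\<close>

lemma ex_binary_tree:
  assumes "A \<subseteq> cantor_space" and "Pi01 A"
  obtains T where "A = paths T" and "tree T" and "udec UNIV (\<lambda>_. T)"
    and "\<And>\<sigma> a. T \<sigma> \<Longrightarrow> a \<in> set \<sigma> \<Longrightarrow> a \<le> 1"
proof -
  obtain R where R: "udec UNIV (\<lambda>_. R)" and A: "A = paths R"
    using assms(2) by (auto simp: Pi01_iff_paths)
  define T where "T \<sigma> \<longleftrightarrow> (\<forall>m<Suc (length \<sigma>). R (take m \<sigma>)) \<and> (\<forall>a\<in>set \<sigma>. a \<le> 1)" for \<sigma>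
  show thesis
  proof (rule that)
    show "A = paths T"
    proof (intro equalityI subsetI)
      fix g assume g: "g \<in> A"
      then have "g i \<in> {0, 1}" for i
        using assms(1) by (auto simp: cantor_space_def)
      then have "g i \<le> 1" for i
        by (metis empty_iff insert_iff le_numeral_extra(4) zero_le)
      then show "g \<in> paths T"
        using g by (intro pathsI) (auto simp: T_def A pathsD set_initseg)
    next
      fix g assume "g \<in> paths T"
      then have "R (take n (initseg g n))" for n
        using pathsD[of g T n] by (auto simp: T_def)
      then show "g \<in> A"
        by (auto simp: A intro: pathsI)
    qed
    show "tree T"
      unfolding tree_def
    proof (intro allI impI)
      fix \<sigma> \<tau> assume "prefix \<sigma> \<tau>" and T: "T \<tau>"
      then obtain \<rho> where \<tau>: "\<tau> = \<sigma> @ \<rho>" by (auto simp: prefix_def)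
      have "R (take m \<sigma>)" if "m < Suc (length \<sigma>)" for m
      proof -
        have "m < Suc (length \<tau>)" using that by (simp add: \<tau>)
        with T have "R (take m \<tau>)" unfolding T_def by blast
        with that show ?thesis by (simp add: \<tau>)
      qed
      with T show "T \<sigma>" by (simp add: T_def \<tau>)
    qed
    show "udec UNIV (\<lambda>_. T)"
      unfolding T_def by (intro ucomp_intros udec_compose[OF R])
    show "a \<le> 1" if "T \<sigma>" "a \<in> set \<sigma>" for \<sigma> a
      using that by (simp add: T_def)
  qed
qed

text \<open>An \<open>(\<omega>, 1)\<close>-computable function may use a different program on each
  argument, so any choice function on \<open>B\<close> will do.\<close>

lemma omega_one_leI:
  assumes "\<And>g. g \<in> B \<Longrightarrow> \<exists>f\<in>A. f \<le>\<^sub>T g"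
  shows "omega_one_le A B"
proof -
  obtain F where F: "\<And>g. g \<in> B \<Longrightarrow> F g \<in> A \<and> F g \<le>\<^sub>T g"
    using assms by metis
  let ?\<Gamma> = "\<lambda>g. if g \<in> B then Some (F g) else None"
  have "omega_one_computable ?\<Gamma>"
    using F by (auto simp: omega_one_computable_def split: if_splits)
  with F show ?thesis
    unfolding omega_one_le_def reducible_via_def by (intro exI[of _ ?\<Gamma>]) auto
qed

lemma not_fin_omega_le:
  assumes "\<And>n. defeats Q n S"
  shows "\<not> fin_omega_le Q S"
proof
  assume "fin_omega_le Q S"
  then obtain \<Gamma> b where b: "\<forall>g\<in>dom \<Gamma>. \<exists>e<b. identified_on \<Gamma> (learner e) g"
    and S: "S \<subseteq> dom \<Gamma>" "\<forall>g\<in>S. the (\<Gamma> g) \<in> Q"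
    unfolding fin_omega_le_def reducible_via_def fin_omega_computable_def by blast
  \<comment> \<open>The first \<open>b\<close> learners, made to guess programs, form a set of at
    most \<open>b\<close> elements.\<close>
  let ?L = "(\<lambda>e \<sigma>. decode (learner e \<sigma>)) ` {..<b}"
  have "finite ?L \<and> card ?L \<le> b"
    using card_image_le[of "{..<b}"] by simp
  then obtain g where g: "g \<in> S" "\<forall>\<Psi>\<in>?L. \<not> succeeds Q \<Psi> g"
    using assms unfolding defeats_def by blast
  have "g \<in> dom \<Gamma>" using g(1) S(1) by blast
  with b obtain e where e: "e < b" "identified_on \<Gamma> (learner e) g" by blast
  define l where "l = lim (\<lambda>n. learner e (initseg g n))"
  have "(\<lambda>n. learner e (initseg g n)) \<longlonglongrightarrow> l"
    using e(2) unfolding l_def identified_on_def by (simp add: convergent_LIMSEQ_iff)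
  \<comment> \<open>A convergent sequence of natural numbers is eventually constant.\<close>
  then have "\<forall>\<^sub>F n in sequentially. learner e (initseg g n) = l"
    by (simp add: tendsto_discrete)
  then have "\<forall>\<^sub>F n in sequentially. decode (learner e (initseg g n)) = decode l"
    by eventually_elim simp
  moreover obtain f where f: "\<Gamma> g = Some f" "f \<in> Q"
    using g(1) S by force
  then have "Phi l g = Some f"
    using e(2) by (simp add: identified_on_def l_def)
  then have "\<forall>x. run g (decode l) x = Some (f x)"
    by (force simp: Phi_def split: if_splits)
  ultimately have "succeeds Q (\<lambda>\<sigma>. decode (learner e \<sigma>)) g"
    using f(2) unfolding succeeds_def by blast
  with g(2) e(1) show False by blast
qed

theorem theorem63:
  fixes P Q :: "(nat \<Rightarrow> nat) set"
  assumes "P \<subseteq> cantor_space" and "Pi01 P" and "special P"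
    and "Q \<subseteq> cantor_space" and "Pi01 Q" and "special Q"
  shows "\<exists>P'. P' \<subseteq> cantor_space \<and> Pi01 P' \<and> \<not> fin_omega_le Q P' \<and> omega_one_equiv P' P"
proof -
  obtain TP where TP: "P = paths TP" "tree TP" "udec UNIV (\<lambda>_. TP)"
    "\<And>\<sigma> a. TP \<sigma> \<Longrightarrow> a \<in> set \<sigma> \<Longrightarrow> a \<le> 1"
    using ex_binary_tree[OF assms(1,2)] by blast
  obtain TQ where TQ: "Q = paths TQ" "tree TQ" "udec UNIV (\<lambda>_. TQ)"
    using ex_binary_tree[OF assms(4,5)] by blast
  interpret pi01_pair P Q TP TQ
    using TP TQ assms(3,6) by unfold_locales (auto simp: special_def)
  \<comment> \<open>Graphs take only the values 0 and 1 and are Turing equivalent to the functions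
    they code.\<close>
  let ?P' = "graph ` paths level_sum"
  have "?P' \<subseteq> cantor_space"
    by (auto simp: cantor_space_def graph_def)
  moreover have "udec UNIV (\<lambda>_. graph_tree level_sum)"
    by (intro udec_graph_tree udec_level_sum ucomp_id)
  then have "Pi01 ?P'"
    using graph_paths[of level_sum] level_sum_bounded unfolding Pi01_iff_paths by blast
  moreover have "\<not> fin_omega_le Q ?P'"
    by (intro not_fin_omega_le defeats_graph defeats_level_sum)
  moreover have "omega_one_le P ?P'"
    using level_sum_computes_P turing_le_graph turing_le_trans by (intro omega_one_leI) blast
  moreover have "omega_one_le ?P' P"
  proof (rule omega_one_leI)
    fix p assume p: "p \<in> P"
    have "ucomp {p} (\<lambda>h n. Suc (h n))"
      by (intro ucomp_intros)
    then have "ucomp {p} (\<lambda>_ n. Suc (p n))"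
      by (rule ucomp_cong) simp
    then have "(\<lambda>n. Suc (p n)) \<le>\<^sub>T p"
      by (simp add: turing_le_iff_ucomp)
    then have "graph (\<lambda>n. Suc (p n)) \<le>\<^sub>T p"
      using graph_turing_le turing_le_trans by blast
    with Suc_in_level_sum[OF p] show "\<exists>f\<in>?P'. f \<le>\<^sub>T p" by blast
  qed
  ultimately show ?thesis
    unfolding omega_one_equiv_def by blast
qed

end
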